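(* Let $P(\lambda)=\sum_{i=0}^kP_i\,n_i(\lambda)$ be an $m\times n$ singular matrix polynomial expressed in the Newton basis associated with nodes $\{x_1,\ldots,x_k\}$. Let $0\le\mu\le k-1$ be an integer, let $A\in\mathbb{C}^{(\mu+1)m\times(k-\mu-1)n}$, $B\in\mathbb{C}^{\mu m\times(k-\mu)n}$, and let $$N(\lambda)=\begin{bmatrix}M_\mu^N(\lambda)+AK_1^N(\lambda)+K_2^N(\lambda)^TB&K_2^N(\lambda)^T\\ K_1^N(\lambda)&0\end{bmatrix}.$$ (a1) Suppose that $\{z_1(\lambda),\ldots,z_p(\lambda)\}$ is a minimal basis for the right nullspace of $N(\lambda)$, with the vector polynomials $z_i$ partitioned into blocks conformable with the blocks of $N(\lambda)$, and let $x_\ell(\lambda)$ be the $(k-\mu)$th block entry of $z_\ell(\lambda)$, for $\ell=1,\ldots,p$. Then $\{x_1(\lambda),\ldots,x_p(\lambda)\}$ is a minimal basis for the right nullspace of $P(\lambda)$. (a2) If $0\le\epsilon_1\le\cdots\le\epsilon_p$ are the right minimal indices of $N(\lambda)$, then $0\le\epsilon_1-k+\mu+1\le\epsilon_2-k+\mu+1\le\cdots\le\epsilon_p-k+\mu+1$ are the right minimal indices of $P(\lambda)$. (b1) Suppose that $\{\omega_1(\lambda),\ldots,\omega_q(\lambda)\}$ is a minimal basis for the left nullspace of $N(\lambda)$, with the vectors $\omega_i$ partitioned into blocks conformable with the blocks of $N(\lambda)$, and let $y_\ell(\lambda)$ be the $(\mu+1)$th block entry of $\omega_\ell(\lambda)$,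 for $\ell=1,\ldots,q$. Then $\{y_1(\lambda),\ldots,y_q(\lambda)\}$ is a minimal basis for the left nullspace of $P(\lambda)$. (b2) If $0\le\mu_1\le\cdots\le\mu_q$ are the left minimal indices of $N(\lambda)$, then $0\le\mu_1-\mu\le\mu_2-\mu\le\cdots\le\mu_q-\mu$ are the left minimal indices of $P(\lambda)$.
   Context: Newton setting. Let $k\ge1$, $m,n\ge1$ and $x_1,\ldots,x_k\in\mathbb{C}$ be distinct nodes. Put $\gamma_j(\lambda)=\lambda-x_j$; the Newton polynomials are $n_0(\lambda)=1$, $n_j(\lambda)=\prod_{\ell=1}^j\gamma_\ell(\lambda)$. For $0\le\mu\le k-1$, $$K_1^N(\lambda)=\begin{bmatrix}-I_n&\gamma_{k-1}(\lambda)I_n\\&-I_n&\gamma_{k-2}(\lambda)I_n\\&&\ddots&\ddots\\&&&-I_n&\gamma_{\mu+1}(\lambda)I_n\end{bmatrix},\quad K_2^N(\lambda)=\begin{bmatrix}-I_m&\gamma_{\mu}(\lambda)I_m\\&-I_m&\gamma_{\mu-1}(\lambda)I_m\\&&\ddots&\ddots\\&&&-I_m&\gamma_{1}(\lambda)I_m\end{bmatrix},$$ of sizes $(k-\mu-1)n\times(k-\mu)n$ and $\mu m\times(\mu+1)m$ ($K_1^N$ is empty if $\mu=k-1$, $K_2^N$ is empty if $\mu=0$). $M_\mu^N(\lambda)$ is the $(\mu+1)\times(k-\mu)$ block matrix with $m\times n$ blocks: if $\mu\le k-2$, its first block row is $[\gamma_k(\lambda)P_k+P_{k-1},P_{k-2},\ldots,P_{\mu+1},P_\mu]$,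 its last block column has, from top to bottom, blocks $P_\mu,P_{\mu-1},\ldots,P_0$, and all other blocks are $0$; if $\mu=k-1$, it is the block column with blocks $\gamma_k(\lambda)P_k+P_{k-1},P_{k-2},\ldots,P_0$. Thus $N(\lambda)$ has block columns consisting of $k-\mu$ blocks of width $n$ followed by $\mu$ blocks of width $m$, and block rows consisting of $\mu+1$ blocks of height $m$ followed by $k-\mu-1$ blocks of height $n$. A matrix polynomial $P(\lambda)$ of size $m\times n$ is singular if $m\ne n$ or $\det P(\lambda)\equiv0$. Its right and left nullspaces are $\mathcal{N}_r(P)=\{x\in\mathbb{C}(\lambda)^{n}:P x=0\}$ and $\mathcal{N}_\ell(P)=\{y\in\mathbb{C}(\lambda)^{m}:y^TP=0\}$. A minimal basis of a rational subspace is a basis consisting of vector polynomials whose sum of degrees is least among all polynomial bases of the subspace; the ordered degrees of its vectors are the minimal indices of the subspace; right (left) minimal indices of $P$ are those of $\mathcal{N}_r(P)$ ($\mathcal{N}_\ell(P)$). *)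

theory Defs
  imports
    "HOL-Computational_Algebra.Polynomial_Factorial"
    "Jordan_Normal_Form.Matrix_Kernel"
begin

definition singular_matpoly :: "complex poly mat \<Rightarrow> bool" where
  "singular_matpoly P \<longleftrightarrow> dim_row P \<noteq> dim_col P \<or> det P = 0"

definition right_nullspace :: "complex poly mat \<Rightarrow> complex poly fract vec set" where
  "right_nullspace P = mat_kernel (map_mat to_fract P)"

text \<open>The equation \<open>y\<^sup>T P = 0\<close> is read in transposed form, \<open>P\<^sup>T y = 0\<close>.\<close>

definition left_nullspace :: "complex poly mat \<Rightarrow> complex poly fract vec set" where
  "left_nullspace P = mat_kernel (transpose_mat (map_mat to_fract P))"

text \<open>
  The value on a zero vector (and on an empty one) is 0; such vectors never occur in a basis.
\<close>

definition vec_degree :: "complex poly vec \<Rightarrow> nat" where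
  "vec_degree v = Max (insert 0 {degree (v $ i) | i. i < dim_vec v})"

text \<open>
  Below, \<open>S\<close> is a subspace of the space of rational vectors of length \<open>d\<close>. Bases are enumerated
  by lists without repetitions, and vector polynomials are embedded by \<^const>\<open>to_fract\<close>.
\<close>

definition polynomial_basis ::
  "nat \<Rightarrow> complex poly fract vec set \<Rightarrow> complex poly vec list \<Rightarrow> bool" where
  "polynomial_basis d S zs \<longleftrightarrow> distinct zs \<and>
     vectorspace.basis class_ring ((module_vec TYPE(complex poly fract) d)\<lparr>carrier := S\<rparr>)
       (map_vec to_fract ` set zs)"

definition minimal_basis ::
  "nat \<Rightarrow> complex poly fract vec set \<Rightarrow> complex poly vec list \<Rightarrow> bool" where
  "minimal_basis d S zs \<longleftrightarrow> polynomial_basis d S zs \<and>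
     (\<forall>ws. polynomial_basis d S ws \<longrightarrow>
        (\<Sum>z\<leftarrow>zs. vec_degree z) \<le> (\<Sum>w\<leftarrow>ws. vec_degree w))"

text \<open>
  The ordered degrees are the same for all minimal bases of a given subspace; the relation
  \<open>are_minimal_indices\<close> does not presuppose this.
\<close>

definition are_minimal_indices ::
  "nat \<Rightarrow> complex poly fract vec set \<Rightarrow> nat list \<Rightarrow> bool" where
  "are_minimal_indices d S es \<longleftrightarrow> (\<exists>zs. minimal_basis d S zs \<and> es = sort (map vec_degree zs))"

definition right_minimal_basis :: "complex poly mat \<Rightarrow> complex poly vec list \<Rightarrow> bool" where
  "right_minimal_basis P = minimal_basis (dim_col P) (right_nullspace P)"

definition left_minimal_basis :: "complex poly mat \<Rightarrow> complex poly vec list \<Rightarrow> bool" where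
  "left_minimal_basis P = minimal_basis (dim_row P) (left_nullspace P)"

definition right_minimal_indices :: "complex poly mat \<Rightarrow> nat list \<Rightarrow> bool" where
  "right_minimal_indices P = are_minimal_indices (dim_col P) (right_nullspace P)"

definition left_minimal_indices :: "complex poly mat \<Rightarrow> nat list \<Rightarrow> bool" where
  "left_minimal_indices P = are_minimal_indices (dim_row P) (left_nullspace P)"

text \<open>
  Nodes \<open>x\<close> and coefficients \<open>P\<close> are indexed as in the usual notation: \<open>x 1, \<dots>, x k\<close> and
  \<open>P 0, \<dots>, P k\<close>. Block rows and block columns are counted from 0.
\<close>

definition node_factor :: "(nat \<Rightarrow> complex) \<Rightarrow> nat \<Rightarrow> complex poly" where
  "node_factor x j = [:- x j, 1:]"

definition newton_poly :: "(nat \<Rightarrow> complex) \<Rightarrow> nat \<Rightarrow> complex poly" where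
  "newton_poly x j = (\<Prod>l=1..j. node_factor x l)"

abbreviation const_mat :: "complex mat \<Rightarrow> complex poly mat" where
  "const_mat \<equiv> map_mat (\<lambda>c. [:c:])"

definition newton_matpoly ::
  "nat \<Rightarrow> nat \<Rightarrow> nat \<Rightarrow> (nat \<Rightarrow> complex) \<Rightarrow> (nat \<Rightarrow> complex mat) \<Rightarrow> complex poly mat" where
  "newton_matpoly m n k x P =
     mat m n (\<lambda>(a, b). \<Sum>i\<le>k. [:P i $$ (a, b):] * newton_poly x i)"

definition blocks_mat :: "nat \<Rightarrow> nat \<Rightarrow> nat \<Rightarrow> nat \<Rightarrow> (nat \<Rightarrow> nat \<Rightarrow> 'a mat) \<Rightarrow> 'a mat" where
  "blocks_mat r c h w F =
     mat (r * h) (c * w) (\<lambda>(i, j). F (i div h) (j div w) $$ (i mod h, j mod w))"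

definition vec_block :: "nat \<Rightarrow> nat \<Rightarrow> 'a vec \<Rightarrow> 'a vec" where
  "vec_block s b v = vec s (\<lambda>i. v $ (b * s + i))"

text \<open>
  \<open>newton_K x s r t\<close> has \<open>r\<close> block rows, blocks of size \<open>s\<close>, and the superdiagonal factors
  \<open>\<gamma>\<^sub>t, \<gamma>\<^sub>t\<^sub>-\<^sub>1, \<dots>\<close> from top to bottom.
\<close>

definition newton_K :: "(nat \<Rightarrow> complex) \<Rightarrow> nat \<Rightarrow> nat \<Rightarrow> nat \<Rightarrow> complex poly mat" where
  "newton_K x s r t = blocks_mat r (r + 1) s s (\<lambda>a b.
     if b = a then - 1\<^sub>m s
     else if b = a + 1 then node_factor x (t - a) \<cdot>\<^sub>m 1\<^sub>m s
     else 0\<^sub>m s s)"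

definition newton_K1 :: "nat \<Rightarrow> nat \<Rightarrow> nat \<Rightarrow> (nat \<Rightarrow> complex) \<Rightarrow> complex poly mat" where
  "newton_K1 n k \<mu> x = newton_K x n (k - \<mu> - 1) (k - 1)"

definition newton_K2 :: "nat \<Rightarrow> nat \<Rightarrow> (nat \<Rightarrow> complex) \<Rightarrow> complex poly mat" where
  "newton_K2 m \<mu> x = newton_K x m \<mu> \<mu>"

text \<open>The case \<open>\<mu> = k - 1\<close> (a single block column) is covered by the same formula.\<close>

definition newton_M ::
  "nat \<Rightarrow> nat \<Rightarrow> nat \<Rightarrow> nat \<Rightarrow> (nat \<Rightarrow> complex) \<Rightarrow> (nat \<Rightarrow> complex mat) \<Rightarrow> complex poly mat" where
  "newton_M m n k \<mu> x P = blocks_mat (\<mu> + 1) (k - \<mu>) m n (\<lambda>a b.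
     if a = 0 \<and> b = 0 then node_factor x k \<cdot>\<^sub>m const_mat (P k) + const_mat (P (k - 1))
     else if a = 0 then const_mat (P (k - 1 - b))
     else if b = k - \<mu> - 1 then const_mat (P (\<mu> - a))
     else 0\<^sub>m m n)"

definition newton_N ::
  "nat \<Rightarrow> nat \<Rightarrow> nat \<Rightarrow> nat \<Rightarrow> (nat \<Rightarrow> complex) \<Rightarrow> (nat \<Rightarrow> complex mat) \<Rightarrow>
     complex mat \<Rightarrow> complex mat \<Rightarrow> complex poly mat" where
  "newton_N m n k \<mu> x P A B =
     four_block_mat
       (newton_M m n k \<mu> x P + const_mat A * newton_K1 n k \<mu> x
          + transpose_mat (newton_K2 m \<mu> x) * const_mat B)
       (transpose_mat (newton_K2 m \<mu> x))
       (newton_K1 n k \<mu> x)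
       (0\<^sub>m ((k - \<mu> - 1) * n) (\<mu> * m))"

end

theory Submission
  imports Defs
begin

text \<open>
  Up to the Kronecker product with an identity matrix, \<open>K\<^sub>1\<close> and \<open>K\<^sub>2\<close> are bidiagonal with an
  invertible constant diagonal, so each of them can be completed to a unimodular matrix; let \<open>L\<^sub>1\<close> and
  \<open>L\<^sub>2\<close> be the resulting polynomial bases of their kernels, normalized by the last block being the
  identity. Then \<open>P = L\<^sub>2\<^sup>T M L\<^sub>1\<close>, and for \<open>P x = 0\<close> the system
  \<open>K\<^sub>2\<^sup>T w = - M L\<^sub>1 x\<close> has a unique, polynomial solution \<open>w\<close>. Hence
  \<open>x \<mapsto> (L\<^sub>1 x, w - B L\<^sub>1 x)\<close> is an isomorphism from the kernel of \<open>P\<close> to that of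
  \<open>N\<close>, whose inverse picks a block and which preserves vector polynomials in both directions.

  It raises every degree by the number \<open>r\<close> of block rows of \<open>K\<^sub>1\<close>: the first block of
  \<open>L\<^sub>1 x\<close> has degree \<open>deg x + r\<close>, and solving for \<open>w\<close> from the bottom upwards only
  involves rows of \<open>M\<close> with constant entries, so that \<open>w\<close> has no larger degree. Such an
  isomorphism maps minimal bases to minimal bases. The transpose of \<open>N\<close> has the same shape with
  \<open>K\<^sub>1\<close> and \<open>K\<^sub>2\<close> exchanged, which gives the left nullspaces.
\<close>

section \<open>Isomorphisms between kernels and minimal bases\<close>

interpretation to_fract_hom: inj_comm_ring_hom to_fract
  by unfold_locales auto

lemma vectorspace_mat_kernel:
  fixes A :: "'a :: field mat"
  assumes "A \<in> carrier_mat nr nc"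
  shows "vectorspace class_ring ((module_vec TYPE('a) nc)\<lparr>carrier := mat_kernel A\<rparr>)"
proof -
  interpret kernel nr nc A using assms by unfold_locales
  show ?thesis by (rule Ker.vectorspace_axioms)
qed

text \<open>A linear bijection carries bases to bases. Finiteness of \<open>X\<close> supplies the
  finite dimension under which \<open>linear_inj_image_is_basis\<close> applies.\<close>

lemma basis_mat_kernel_iso:
  fixes A B :: "'a :: field mat"
  assumes A: "A \<in> carrier_mat nr nc" and B: "B \<in> carrier_mat nr' nc'"
    and f: "bij_betw f (mat_kernel A) (mat_kernel B)"
    and add: "\<And>u v. u \<in> carrier_vec nc \<Longrightarrow> v \<in> carrier_vec nc \<Longrightarrow> f (u + v) = f u + f v"
    and smult: "\<And>c v. v \<in> carrier_vec nc \<Longrightarrow> f (c \<cdot>\<^sub>v v) = c \<cdot>\<^sub>v f v"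
    and bas: "vectorspace.basis class_ring ((module_vec TYPE('a) nc)\<lparr>carrier := mat_kernel A\<rparr>) X"
    and fin: "finite X"
  shows "vectorspace.basis class_ring ((module_vec TYPE('a) nc')\<lparr>carrier := mat_kernel B\<rparr>) (f ` X)"
proof -
  let ?V = "(module_vec TYPE('a) nc)\<lparr>carrier := mat_kernel A\<rparr>"
  let ?W = "(module_vec TYPE('a) nc')\<lparr>carrier := mat_kernel B\<rparr>"
  interpret V: vectorspace class_ring ?V by (rule vectorspace_mat_kernel[OF A])
  interpret W: vectorspace class_ring ?W by (rule vectorspace_mat_kernel[OF B])
  have sub: "mat_kernel A \<subseteq> carrier_vec nc"
    using A by (auto simp: mat_kernel_def)
  have hom: "f \<in> LinearCombinations.module_hom class_ring ?V ?W"
    using f sub unfolding LinearCombinations.module_hom_def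
    by (auto simp: module_vec_simps bij_betw_def intro!: add smult)
  interpret linear_map class_ring ?V ?W f
    by unfold_locales (rule hom)
  show ?thesis
  proof (rule linear_inj_image_is_basis)
    show "inj_on f (carrier ?V)" "f ` carrier ?V = carrier ?W"
      using f by (auto simp: bij_betw_def)
    show "V.basis X" by (rule bas)
    show "V.fin_dim"
      using bas fin unfolding V.fin_dim_def V.basis_def by auto
  qed
qed

section \<open>Polynomial vectors inside rational nullspaces\<close>

lemma map_to_fract_mult_vec:
  assumes "A \<in> carrier_mat nr nc" "v \<in> carrier_vec nc"
  shows "map_mat to_fract A *\<^sub>v map_vec to_fract v = map_vec to_fract (A *\<^sub>v v)"
  using to_fract_hom.mult_mat_vec_hom[OF assms] by simp

lemma map_to_fract_add:
  "X \<in> carrier_mat p q \<Longrightarrow> Z \<in> carrier_mat p q \<Longrightarrow>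
    map_mat to_fract (X + Z) = map_mat to_fract X + map_mat to_fract (Z :: complex poly mat)"
  by (intro eq_matI) (auto simp: to_fract_hom.hom_add)

lemma map_to_fract_minus:
  "X \<in> carrier_mat p q \<Longrightarrow> Z \<in> carrier_mat p q \<Longrightarrow>
    map_mat to_fract (X - Z) = map_mat to_fract X - map_mat to_fract (Z :: complex poly mat)"
  by (intro eq_matI) (auto simp: to_fract_hom.hom_minus)

lemma map_to_fract_zero: "map_mat to_fract (0\<^sub>m p q) = 0\<^sub>m p q"
  by (intro eq_matI) auto

lemma map_to_fract_transpose: "map_mat to_fract (X\<^sup>T) = (map_mat to_fract X)\<^sup>T"
  by (intro eq_matI) auto

lemma to_fract_mem_right_nullspace:
  assumes "A \<in> carrier_mat nr nc"
  shows "map_vec to_fract v \<in> right_nullspace A \<longleftrightarrow> v \<in> carrier_vec nc \<and> A *\<^sub>v v = 0\<^sub>v nr"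
proof (cases "v \<in> carrier_vec nc")
  case True
  then show ?thesis
    using assms map_to_fract_mult_vec[OF assms True]
    by (auto simp: right_nullspace_def mat_kernel_def)
next
  case False
  then show ?thesis
    using assms by (auto simp: right_nullspace_def mat_kernel_def)
qed

lemma polynomial_basisD:
  assumes "A \<in> carrier_mat nr nc" "polynomial_basis nc (right_nullspace A) zs" "z \<in> set zs"
  shows "z \<in> carrier_vec nc" "A *\<^sub>v z = 0\<^sub>v nr" "z \<noteq> 0\<^sub>v nc"
proof -
  let ?V = "(module_vec TYPE(complex poly fract) nc)\<lparr>carrier := right_nullspace A\<rparr>"
  have "map_mat to_fract A \<in> carrier_mat nr nc" using assms(1) by simp
  then interpret kernel nr nc "map_mat to_fract A" by unfold_locales
  have b: "basis (map_vec to_fract ` set zs)"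
    using assms(2) by (simp add: polynomial_basis_def right_nullspace_def)
  then have mem: "map_vec to_fract z \<in> right_nullspace A"
    using assms(3) by (auto simp: Ker.basis_def right_nullspace_def)
  then show "z \<in> carrier_vec nc" "A *\<^sub>v z = 0\<^sub>v nr"
    using to_fract_mem_right_nullspace[OF assms(1)] by auto
  have "0\<^sub>v nc \<notin> map_vec to_fract ` set zs"
    using b Ker.vs_zero_lin_dep[of "map_vec to_fract ` set zs"] by (auto simp: Ker.basis_def)
  then show "z \<noteq> 0\<^sub>v nc"
    using assms(3) by (metis image_eqI to_fract_hom.vec_hom_zero)
qed

text \<open>Injectivity of the embedding and distinctness of the list make its length the dimension.
  Hence all polynomial bases of a nullspace have equal length, and a uniform degree shift changes
  all their degree sums by the same constant.\<close>

lemma length_polynomial_basis: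
  assumes "A \<in> carrier_mat nr nc" "polynomial_basis nc (right_nullspace A) zs"
  shows "length zs = vectorspace.dim class_ring
    ((module_vec TYPE(complex poly fract) nc)\<lparr>carrier := right_nullspace A\<rparr>)"
proof -
  have "map_mat to_fract A \<in> carrier_mat nr nc" using assms(1) by simp
  then interpret kernel nr nc "map_mat to_fract A" by unfold_locales
  have "dim = card (map_vec to_fract ` set zs)"
    using assms(2) by (intro Ker.dim_basis) (auto simp: polynomial_basis_def right_nullspace_def)
  also have "\<dots> = card (set zs)"
    by (intro card_image inj_onI) (simp add: to_fract_hom.vec_hom_inj)
  also have "\<dots> = length zs"
    using assms(2) by (simp add: polynomial_basis_def distinct_card)
  finally show ?thesis by (simp add: right_nullspace_def)
qed

text \<open>Here \<open>g\<close> is the restriction of \<open>f\<close> to vector polynomials.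
  Since bases are lists, distinctness of the image list has to be established too; it follows from
  injectivity of \<open>f\<close> on the nullspace.\<close>

lemma polynomial_basis_iso:
  assumes A: "A \<in> carrier_mat nr nc" and B: "B \<in> carrier_mat nr' nc'"
    and f: "bij_betw f (right_nullspace A) (right_nullspace B)"
    and add: "\<And>u v. u \<in> carrier_vec nc \<Longrightarrow> v \<in> carrier_vec nc \<Longrightarrow> f (u + v) = f u + f v"
    and smult: "\<And>c v. v \<in> carrier_vec nc \<Longrightarrow> f (c \<cdot>\<^sub>v v) = c \<cdot>\<^sub>v f v"
    and poly: "\<And>v. v \<in> carrier_vec nc \<Longrightarrow> f (map_vec to_fract v) = map_vec to_fract (g v)"
    and zs: "polynomial_basis nc (right_nullspace A) zs"
  shows "polynomial_basis nc' (right_nullspace B) (map g zs)"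
proof -
  have car: "set zs \<subseteq> carrier_vec nc"
    using polynomial_basisD(1)[OF A zs] by auto
  then have img: "f ` map_vec to_fract ` set zs = map_vec to_fract ` set (map g zs)"
    using poly by (force simp: image_image)
  have "inj_on (map_vec to_fract \<circ> g) (set zs)"
  proof (rule inj_onI)
    fix u v assume uv: "u \<in> set zs" "v \<in> set zs" "(map_vec to_fract \<circ> g) u = (map_vec to_fract \<circ> g) v"
    have "map_vec to_fract u \<in> right_nullspace A" "map_vec to_fract v \<in> right_nullspace A"
      using polynomial_basisD[OF A zs] uv to_fract_mem_right_nullspace[OF A] by auto
    moreover have "f (map_vec to_fract u) = f (map_vec to_fract v)"
      using uv poly[of u] poly[of v] car by (metis comp_apply subsetD)
    ultimately show "u = v"
      using f by (auto simp: bij_betw_def inj_on_def to_fract_hom.vec_hom_inj)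
  qed
  then have "distinct (map g zs)"
    using zs by (simp add: polynomial_basis_def distinct_map inj_on_imageI2)
  moreover have "vectorspace.basis class_ring
      ((module_vec TYPE(complex poly fract) nc')\<lparr>carrier := right_nullspace B\<rparr>)
      (f ` map_vec to_fract ` set zs)"
    unfolding right_nullspace_def
    by (rule basis_mat_kernel_iso[where A = "map_mat to_fract A" and nr = nr and nr' = nr' and nc = nc])
      (use A B f add smult zs in \<open>auto simp: polynomial_basis_def right_nullspace_def\<close>)
  ultimately show ?thesis
    unfolding polynomial_basis_def img by simp
qed

text \<open>
  A shift of all degrees by the same amount does not affect which bases are minimal, because
  all bases have the same number of elements.
\<close>

lemma minimal_basis_iso:
  assumes A: "A \<in> carrier_mat nr nc" and B: "B \<in> carrier_mat nr' nc'"
    and f: "bij_betw f (right_nullspace A) (right_nullspace B)"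
    and add: "\<And>u v. u \<in> carrier_vec nc \<Longrightarrow> v \<in> carrier_vec nc \<Longrightarrow> f (u + v) = f u + f v"
    and smult: "\<And>c v. v \<in> carrier_vec nc \<Longrightarrow> f (c \<cdot>\<^sub>v v) = c \<cdot>\<^sub>v f v"
    and f_poly: "\<And>v. v \<in> carrier_vec nc \<Longrightarrow> f (map_vec to_fract v) = map_vec to_fract (g v)"
    and T: "T \<in> carrier_mat nc nc'"
    and fT: "\<And>y. y \<in> right_nullspace B \<Longrightarrow>
      map_mat to_fract T *\<^sub>v y \<in> right_nullspace A \<and> f (map_mat to_fract T *\<^sub>v y) = y"
    and deg: "\<And>y. y \<in> carrier_vec nc' \<Longrightarrow> y \<noteq> 0\<^sub>v nc' \<Longrightarrow> B *\<^sub>v y = 0\<^sub>v nr' \<Longrightarrow>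
      vec_degree (T *\<^sub>v y) = vec_degree y + d"
    and zs: "minimal_basis nc (right_nullspace A) zs"
  shows "minimal_basis nc' (right_nullspace B) (map g zs) \<and>
    (\<forall>z\<in>set zs. vec_degree z = vec_degree (g z) + d)"
proof -
  let ?T = "map_mat to_fract T"
  have zsb: "polynomial_basis nc (right_nullspace A) zs"
    using zs by (simp add: minimal_basis_def)
  have gzs: "polynomial_basis nc' (right_nullspace B) (map g zs)"
    by (rule polynomial_basis_iso[OF A B f add smult f_poly zsb])
  \<comment> \<open>By hypothesis \<open>T\<close> is a right inverse of \<open>f\<close>;
    injectivity of \<open>f\<close> makes it a two-sided one.\<close>
  have inv: "?T *\<^sub>v f x = x" if "x \<in> right_nullspace A" for x
    using bij_betw_imp_inj_on[OF f] fT[OF bij_betw_apply[OF f that]] that by (simp add: inj_on_def)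
  have Tbij: "bij_betw ((*\<^sub>v) ?T) (right_nullspace B) (right_nullspace A)"
    using inv fT bij_betw_apply[OF f] by (intro bij_betw_byWitness[where f' = f]) auto
  \<comment> \<open>The degree hypothesis speaks of \<open>T\<close>, so \<open>z\<close> is first
    written as \<open>T\<close> applied to \<open>g z\<close>.\<close>
  have degz: "vec_degree z = vec_degree (g z) + d" if "z \<in> set zs" for z
  proof -
    have gz: "g z \<in> set (map g zs)" using that by simp
    note gzD = polynomial_basisD[OF B gzs gz] and zD = polynomial_basisD[OF A zsb that]
    have "map_vec to_fract z = ?T *\<^sub>v f (map_vec to_fract z)"
      using zD to_fract_mem_right_nullspace[OF A] by (intro inv[symmetric]) auto
    also have "\<dots> = map_vec to_fract (T *\<^sub>v g z)"
      using zD(1) gzD(1) by (simp add: f_poly map_to_fract_mult_vec[OF T])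
    finally have "z = T *\<^sub>v g z"
      by (rule to_fract_hom.vec_hom_inj)
    then show ?thesis
      using deg[OF gzD(1,3,2)] by simp
  qed
  \<comment> \<open>A competing basis \<open>ws\<close> is carried by \<open>T\<close> to a
    competitor of \<open>zs\<close>. Both degree sums then exceed those on the other side by
    \<open>d\<close> times the common length, which cancels.\<close>
  have "(\<Sum>z\<leftarrow>map g zs. vec_degree z) \<le> (\<Sum>w\<leftarrow>ws. vec_degree w)"
    if ws: "polynomial_basis nc' (right_nullspace B) ws" for ws
  proof -
    have car: "map_mat to_fract T \<in> carrier_mat nc nc'" using T by simp
    have "polynomial_basis nc (right_nullspace A) (map ((*\<^sub>v) T) ws)"
      by (rule polynomial_basis_iso[OF B A Tbij _ _ _ ws])
        (use map_to_fract_mult_vec[OF T] in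
          \<open>auto simp: mult_add_distrib_mat_vec[OF car] mult_mat_vec[OF car]\<close>)
    then have "sum_list (map vec_degree zs) \<le> sum_list (map vec_degree (map ((*\<^sub>v) T) ws))"
      using zs unfolding minimal_basis_def by blast
    moreover have "map vec_degree (map ((*\<^sub>v) T) ws) = map (\<lambda>w. vec_degree w + d) ws"
      using polynomial_basisD[OF B ws] deg by simp
    then have "sum_list (map vec_degree (map ((*\<^sub>v) T) ws)) = sum_list (map vec_degree ws) + length ws * d"
      by (simp add: sum_list_addf sum_list_triv del: map_map)
    moreover have "sum_list (map vec_degree zs) = (\<Sum>z\<leftarrow>zs. vec_degree (g z) + d)"
      using degz by (intro arg_cong[of _ _ sum_list] map_cong) auto
    then have "sum_list (map vec_degree zs) = sum_list (map vec_degree (map g zs)) + length zs * d"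
      by (simp add: comp_def sum_list_addf sum_list_triv)
    moreover have "length zs = length ws"
      using length_polynomial_basis[OF B gzs] length_polynomial_basis[OF B ws] by simp
    ultimately show ?thesis by simp
  qed
  with gzs degz show ?thesis
    by (auto simp: minimal_basis_def)
qed

text \<open>Truncated subtraction is monotone, so it keeps a sorted list sorted.\<close>

lemma sort_map_minus:
  fixes d :: nat
  shows "sort (map (\<lambda>e. e - d) es) = map (\<lambda>e. e - d) (sort es)"
  by (rule properties_for_sort) (auto intro!: sorted_map_mono[of "sort es"] simp: mono_on_def)

text \<open>Every index of \<open>S\<close> is a degree of the form
  \<open>vec_degree (f z) + r\<close>. This gives the lower bound \<open>r\<close> and makes the
  truncated subtraction exact.\<close>

lemma are_minimal_indices_shift:
  assumes bas: "\<And>zs. minimal_basis d S zs \<Longrightarrow> minimal_basis d' S' (map f zs) \<and>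
      (\<forall>z\<in>set zs. vec_degree z = vec_degree (f z) + r)"
    and es: "are_minimal_indices d S es"
  shows "(\<forall>e\<in>set es. r \<le> e) \<and> are_minimal_indices d' S' (map (\<lambda>e. e - r) es)"
proof -
  obtain zs where zs: "minimal_basis d S zs" and es: "es = sort (map vec_degree zs)"
    using es by (auto simp: are_minimal_indices_def)
  have "map (\<lambda>e. e - r) (map vec_degree zs) = map vec_degree (map f zs)"
    using bas[OF zs] by simp
  then have "map (\<lambda>e. e - r) es = sort (map vec_degree (map f zs))"
    unfolding es by (metis sort_map_minus)
  with bas[OF zs] es show ?thesis
    by (auto simp: are_minimal_indices_def)
qed

section \<open>Pencils with two completable blocks\<close>

lemma zero_mat_mult_vec [simp]: "v \<in> carrier_vec n \<Longrightarrow> 0\<^sub>m k n *\<^sub>v v = 0\<^sub>v k"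
  by (intro eq_vecI) (auto simp: row_def scalar_prod_def)

lemma mult_mat_zero_vec [simp]: "A \<in> carrier_mat k n \<Longrightarrow> A *\<^sub>v 0\<^sub>v n = 0\<^sub>v k"
  by (intro eq_vecI) auto

text \<open>
  The square matrix with block rows \<open>K\<close> and \<open>E\<close> is unimodular, with inverse \<open>[- Y, L]\<close>.
\<close>

definition unimodular_completion ::
  "nat \<Rightarrow> nat \<Rightarrow> nat \<Rightarrow> 'a :: comm_ring_1 mat \<Rightarrow> 'a mat \<Rightarrow> 'a mat \<Rightarrow> 'a mat \<Rightarrow> bool" where
  "unimodular_completion p q s K E Y L \<longleftrightarrow>
     K \<in> carrier_mat p q \<and> E \<in> carrier_mat s q \<and> Y \<in> carrier_mat q p \<and> L \<in> carrier_mat q s \<and>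
     K * Y = - 1\<^sub>m p \<and> K * L = 0\<^sub>m p s \<and> E * L = 1\<^sub>m s \<and> L * E = 1\<^sub>m q + Y * K"

text \<open>An arbitrary commutative ring is allowed because the setting is instantiated twice: with
  polynomials, where degrees make sense, and with their fractions, where the nullspaces
  live.\<close>

locale block_pencil =
  fixes p1 q1 s1 p2 q2 s2 :: nat
    and K1 E1 Y1 L1 K2 E2 Y2 L2 M A B :: "'a :: comm_ring_1 mat"
  assumes completion1: "unimodular_completion p1 q1 s1 K1 E1 Y1 L1"
    and completion2: "unimodular_completion p2 q2 s2 K2 E2 Y2 L2"
    and M: "M \<in> carrier_mat q2 q1"
    and A: "A \<in> carrier_mat q2 p1"
    and B: "B \<in> carrier_mat p2 q1"
begin

definition "pencil = four_block_mat (M + A * K1 + K2\<^sup>T * B) K2\<^sup>T K1 (0\<^sub>m p1 p2)"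
definition "reduced = L2\<^sup>T * (M * L1)"
text \<open>With \<open>u = L1 x\<close>, the product of the transpose of \<open>Y2\<close> with
  \<open>M u\<close> is the solution \<open>w\<close> of the first block row for
  \<open>B = 0\<close>; subtracting \<open>B u\<close> accounts for general
  \<open>B\<close>.\<close>

definition "lift = L1 @\<^sub>r ((Y2\<^sup>T * M - B) * L1)"

lemma carriers:
  "K1 \<in> carrier_mat p1 q1" "E1 \<in> carrier_mat s1 q1" "Y1 \<in> carrier_mat q1 p1" "L1 \<in> carrier_mat q1 s1"
  "K2 \<in> carrier_mat p2 q2" "E2 \<in> carrier_mat s2 q2" "Y2 \<in> carrier_mat q2 p2" "L2 \<in> carrier_mat q2 s2"
  using completion1 completion2 by (simp_all add: unimodular_completion_def)

lemmas dims [simp] = carriers M A B carriers[THEN carrier_matD(1)] carriers[THEN carrier_matD(2)]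
  M[THEN carrier_matD(1)] M[THEN carrier_matD(2)] A[THEN carrier_matD(1)] A[THEN carrier_matD(2)]
  B[THEN carrier_matD(1)] B[THEN carrier_matD(2)]

lemmas mult_vec_simps [simp] = carriers[THEN mult_mat_zero_vec] M[THEN mult_mat_zero_vec]
  A[THEN mult_mat_zero_vec] B[THEN mult_mat_zero_vec]
  carriers[THEN transpose_carrier_mat[THEN iffD2], THEN mult_mat_zero_vec]
  carriers[THEN mult_mat_vec_carrier] M[THEN mult_mat_vec_carrier]
  A[THEN mult_mat_vec_carrier] B[THEN mult_mat_vec_carrier]
  carriers[THEN transpose_carrier_mat[THEN iffD2], THEN mult_mat_vec_carrier]

lemma pencil_carrier: "pencil \<in> carrier_mat (q2 + p1) (q1 + p2)"
  and reduced_carrier: "reduced \<in> carrier_mat s2 s1"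
  and lift_carrier: "lift \<in> carrier_mat (q1 + p2) s1"
proof -
  show "pencil \<in> carrier_mat (q2 + p1) (q1 + p2)"
    unfolding pencil_def by (intro four_block_carrier_mat) auto
  show "reduced \<in> carrier_mat s2 s1"
    unfolding reduced_def by (intro mult_carrier_mat[of _ _ q2] mult_carrier_mat[of M _ q1]) auto
  show "lift \<in> carrier_mat (q1 + p2) s1"
    unfolding lift_def by (intro carrier_append_rows mult_carrier_mat[of _ _ q1] minus_carrier_mat) auto
qed

lemma K1_L1_vec: "x \<in> carrier_vec s1 \<Longrightarrow> K1 *\<^sub>v (L1 *\<^sub>v x) = 0\<^sub>v p1"
  using completion1 assoc_mult_mat_vec[of K1 p1 q1 L1 s1 x]
  by (simp add: unimodular_completion_def)

text \<open>On the kernel of \<open>K1\<close> the correction \<open>Y1 * K1\<close> vanishes, so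
  \<open>E1\<close> reads off the coordinates of \<open>u\<close> with respect to the columns of
  \<open>L1\<close>.\<close>

lemma L1_E1_vec: "u \<in> carrier_vec q1 \<Longrightarrow> K1 *\<^sub>v u = 0\<^sub>v p1 \<Longrightarrow> L1 *\<^sub>v (E1 *\<^sub>v u) = u"
  using completion1 assoc_mult_mat_vec[of L1 q1 s1 E1 q1 u] assoc_mult_mat_vec[of Y1 q1 p1 K1 q1 u]
  by (simp add: unimodular_completion_def add_mult_distrib_mat_vec[of _ q1 q1] mult_carrier_mat[of Y1 q1 p1])

lemma L2_K2_vec:
  assumes "v \<in> carrier_vec p2"
  shows "L2\<^sup>T *\<^sub>v (K2\<^sup>T *\<^sub>v v) = 0\<^sub>v s2"
proof -
  have "L2\<^sup>T * K2\<^sup>T = 0\<^sub>m s2 p2"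
    using completion2 transpose_mult[of K2 p2 q2 L2 s2]
    by (simp add: unimodular_completion_def)
  then show ?thesis
    using assms assoc_mult_mat_vec[of "L2\<^sup>T" s2 q2 "K2\<^sup>T" p2 v] by simp
qed

text \<open>Uniqueness for the system with the transpose of \<open>K2\<close>: up to sign, the
  transpose of \<open>Y2\<close> is a left inverse.\<close>

lemma Y2_K2_vec:
  assumes "v \<in> carrier_vec p2"
  shows "Y2\<^sup>T *\<^sub>v (K2\<^sup>T *\<^sub>v v) = - v"
proof -
  have "Y2\<^sup>T * K2\<^sup>T = - 1\<^sub>m p2"
    using completion2 transpose_mult[of K2 p2 q2 Y2 p2]
    by (simp add: unimodular_completion_def transpose_uminus)
  then show ?thesis
    using assms assoc_mult_mat_vec[of "Y2\<^sup>T" p2 q2 "K2\<^sup>T" p2 v] by simp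
qed

text \<open>Existence for the same system: the transpose of \<open>Y2\<close> produces a solution
  for the right-hand side \<open>- h\<close>, and the only obstruction is the image of
  \<open>h\<close> under the transpose of \<open>L2\<close>.\<close>

lemma K2_Y2_vec:
  assumes "h \<in> carrier_vec q2"
  shows "K2\<^sup>T *\<^sub>v (Y2\<^sup>T *\<^sub>v h) = E2\<^sup>T *\<^sub>v (L2\<^sup>T *\<^sub>v h) - h"
proof -
  have "E2\<^sup>T * L2\<^sup>T = (1\<^sub>m q2 + Y2 * K2)\<^sup>T"
    using completion2 transpose_mult[of L2 q2 s2 E2 q2]
    by (simp add: unimodular_completion_def)
  also have "\<dots> = 1\<^sub>m q2 + K2\<^sup>T * Y2\<^sup>T"
    using transpose_mult[of Y2 q2 p2 K2 q2] transpose_add[of "1\<^sub>m q2" q2 q2 "Y2 * K2"]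
    by (simp add: mult_carrier_mat[of Y2 q2 p2])
  finally have "E2\<^sup>T *\<^sub>v (L2\<^sup>T *\<^sub>v h) = h + K2\<^sup>T *\<^sub>v (Y2\<^sup>T *\<^sub>v h)"
    using assms assoc_mult_mat_vec[of "E2\<^sup>T" q2 s2 "L2\<^sup>T" q2 h]
      assoc_mult_mat_vec[of "K2\<^sup>T" q2 p2 "Y2\<^sup>T" q2 h]
    by (simp add: add_mult_distrib_mat_vec[of _ q2 q2] mult_carrier_mat[of _ q2 p2])
  then show ?thesis
    using assms by auto
qed

lemma lift_mult_vec:
  assumes x: "x \<in> carrier_vec s1"
  defines "u \<equiv> L1 *\<^sub>v x"
  shows "lift *\<^sub>v x = u @\<^sub>v (Y2\<^sup>T *\<^sub>v (M *\<^sub>v u) - B *\<^sub>v u)"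
proof -
  have u: "u \<in> carrier_vec q1" using x unfolding u_def by auto
  have "lift *\<^sub>v x = u @\<^sub>v (((Y2\<^sup>T * M - B) * L1) *\<^sub>v x)"
    unfolding lift_def u_def by (rule mat_mult_append[OF _ _ x]) auto
  also have "((Y2\<^sup>T * M - B) * L1) *\<^sub>v x = (Y2\<^sup>T * M - B) *\<^sub>v u"
    unfolding u_def by (rule assoc_mult_mat_vec[OF _ _ x]) auto
  also have "\<dots> = Y2\<^sup>T *\<^sub>v (M *\<^sub>v u) - B *\<^sub>v u"
    using u
    by (subst minus_mult_distrib_mat_vec[of _ p2 q1])
      (auto intro: mult_carrier_mat[of _ _ q2] simp: assoc_mult_mat_vec[of _ p2 q2 _ q1])
  finally show ?thesis .
qed

lemma reduced_mult_vec: "x \<in> carrier_vec s1 \<Longrightarrow> reduced *\<^sub>v x = L2\<^sup>T *\<^sub>v (M *\<^sub>v (L1 *\<^sub>v x))"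
  unfolding reduced_def by (subst assoc_mult_mat_vec[of _ s2 q2 _ s1], auto simp: assoc_mult_mat_vec[of _ q2 q1 _ s1])

lemma pencil_mult_append:
  assumes "u \<in> carrier_vec q1" "v \<in> carrier_vec p2"
  shows "pencil *\<^sub>v (u @\<^sub>v v) =
    (M *\<^sub>v u + A *\<^sub>v (K1 *\<^sub>v u) + K2\<^sup>T *\<^sub>v (B *\<^sub>v u) + K2\<^sup>T *\<^sub>v v) @\<^sub>v (K1 *\<^sub>v u)"
  using assms unfolding pencil_def
  by (subst four_block_mat_mult_vec[of _ q2 q1 _ p2 _ p1])
    (auto simp: add_mult_distrib_mat_vec[of _ q2 q1] assoc_mult_mat_vec[of _ q2 p1 _ q1]
      assoc_mult_mat_vec[of _ q2 p2 _ q1] mult_carrier_mat[of _ q2 p1] mult_carrier_mat[of _ q2 p2])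

text \<open>The obstruction to solvability for \<open>h\<close> is precisely \<open>reduced\<close>
  applied to \<open>x\<close>.\<close>

lemma K2_Y2_M_L1_vec:
  assumes x: "x \<in> carrier_vec s1" "reduced *\<^sub>v x = 0\<^sub>v s2"
  defines "h \<equiv> M *\<^sub>v (L1 *\<^sub>v x)"
  shows "K2\<^sup>T *\<^sub>v (Y2\<^sup>T *\<^sub>v h) = - h"
proof -
  have h: "h \<in> carrier_vec q2" unfolding h_def using x by auto
  have "L2\<^sup>T *\<^sub>v h = 0\<^sub>v s2" using x reduced_mult_vec h_def by simp
  then show ?thesis
    using h by (auto simp: K2_Y2_vec)
qed

text \<open>The \<open>A\<close> term vanishes because \<open>K1\<close> annihilates
  \<open>u\<close>, and the \<open>B\<close> term cancels against the correction built into
  \<open>lift\<close>.\<close>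

lemma pencil_mult_lift:
  assumes x: "x \<in> carrier_vec s1" "reduced *\<^sub>v x = 0\<^sub>v s2"
  shows "pencil *\<^sub>v (lift *\<^sub>v x) = 0\<^sub>v (q2 + p1)"
proof -
  define u where "u = L1 *\<^sub>v x"
  define h where "h = M *\<^sub>v u"
  define b where "b = K2\<^sup>T *\<^sub>v (B *\<^sub>v u)"
  have u: "u \<in> carrier_vec q1" unfolding u_def using x by auto
  then have h: "h \<in> carrier_vec q2" and b: "b \<in> carrier_vec q2"
    unfolding h_def b_def by auto
  have "K2\<^sup>T *\<^sub>v (Y2\<^sup>T *\<^sub>v h - B *\<^sub>v u) = - h - b"
    using u h K2_Y2_M_L1_vec[OF x] unfolding b_def h_def u_def
    by (subst mult_minus_distrib_mat_vec[of _ q2 p2]) auto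
  moreover have "A *\<^sub>v (K1 *\<^sub>v u) = 0\<^sub>v q2"
    using x K1_L1_vec by (simp add: u_def)
  moreover have "h + 0\<^sub>v q2 + b + (- h - b) = 0\<^sub>v q2"
    using h b by auto
  ultimately have "pencil *\<^sub>v (lift *\<^sub>v x) = 0\<^sub>v q2 @\<^sub>v 0\<^sub>v p1"
    using x u h pencil_mult_append[of u "Y2\<^sup>T *\<^sub>v h - B *\<^sub>v u"] K1_L1_vec[OF x(1)]
    by (simp add: lift_mult_vec u_def h_def b_def)
  then show ?thesis by auto
qed

text \<open>The second block row puts \<open>u\<close> into the kernel of \<open>K1\<close>, so
  \<open>E1\<close> determines it. Multiplying the first block row by the transpose of
  \<open>L2\<close> eliminates \<open>K2\<close> and leaves the equation for \<open>reduced\<close>;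
  multiplying it by the transpose of \<open>Y2\<close> solves for \<open>v\<close>.\<close>

lemma pencil_kernel:
  assumes u: "u \<in> carrier_vec q1" and v: "v \<in> carrier_vec p2"
    and ker: "pencil *\<^sub>v (u @\<^sub>v v) = 0\<^sub>v (q2 + p1)"
  shows "reduced *\<^sub>v (E1 *\<^sub>v u) = 0\<^sub>v s2" "lift *\<^sub>v (E1 *\<^sub>v u) = u @\<^sub>v v"
proof -
  define h where "h = M *\<^sub>v u"
  define w where "w = B *\<^sub>v u"
  have h: "h \<in> carrier_vec q2" and w: "w \<in> carrier_vec p2"
    unfolding h_def w_def using u by auto
  have "(h + A *\<^sub>v (K1 *\<^sub>v u) + K2\<^sup>T *\<^sub>v w + K2\<^sup>T *\<^sub>v v) @\<^sub>v (K1 *\<^sub>v u) = 0\<^sub>v q2 @\<^sub>v 0\<^sub>v p1"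
    using ker pencil_mult_append[OF u v] by (auto simp: h_def w_def)
  then have K1u: "K1 *\<^sub>v u = 0\<^sub>v p1"
    and row: "h + A *\<^sub>v (K1 *\<^sub>v u) + K2\<^sup>T *\<^sub>v w + K2\<^sup>T *\<^sub>v v = 0\<^sub>v q2"
    using h u v w by (subst (asm) append_vec_eq[of _ q2]; simp)+
  \<comment> \<open>Once the \<open>A\<close> term is gone, \<open>B u\<close> and \<open>v\<close>
    enter only through their sum, which becomes the unknown.\<close>
  have "K2\<^sup>T *\<^sub>v (w + v) = K2\<^sup>T *\<^sub>v w + K2\<^sup>T *\<^sub>v v"
    using w v by (intro mult_add_distrib_mat_vec[of _ q2 p2]) auto
  then have row: "h + K2\<^sup>T *\<^sub>v (w + v) = 0\<^sub>v q2"
    using row h w v K1u by (simp add: assoc_add_vec[of _ q2])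
  have "L2\<^sup>T *\<^sub>v (h + K2\<^sup>T *\<^sub>v (w + v)) = L2\<^sup>T *\<^sub>v h"
    using w v h L2_K2_vec[of "w + v"] by (subst mult_add_distrib_mat_vec[of _ s2 q2]) auto
  with row have "L2\<^sup>T *\<^sub>v h = 0\<^sub>v s2" by simp
  then show "reduced *\<^sub>v (E1 *\<^sub>v u) = 0\<^sub>v s2"
    using u by (simp add: reduced_mult_vec L1_E1_vec K1u h_def)
  have "Y2\<^sup>T *\<^sub>v (h + K2\<^sup>T *\<^sub>v (w + v)) = Y2\<^sup>T *\<^sub>v h - (w + v)"
    using w v h Y2_K2_vec[of "w + v"] by (subst mult_add_distrib_mat_vec[of _ p2 q2]) auto
  with row have "Y2\<^sup>T *\<^sub>v h - (w + v) = 0\<^sub>v p2" by simp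
  then have "Y2\<^sup>T *\<^sub>v h - w = v"
    using w v h by (auto simp: vec_eq_iff algebra_simps)
  then show "lift *\<^sub>v (E1 *\<^sub>v u) = u @\<^sub>v v"
    using u by (simp add: lift_mult_vec L1_E1_vec K1u h_def w_def)
qed

end

section \<open>Embedding of polynomial pencils into rational functions\<close>

lemma unimodular_completion_to_fract:
  fixes K :: "complex poly mat"
  assumes "unimodular_completion p q s K E Y L"
  shows "unimodular_completion p q s (map_mat to_fract K) (map_mat to_fract E)
    (map_mat to_fract Y) (map_mat to_fract L)"
proof -
  have um: "map_mat to_fract (- X) = - map_mat to_fract X" for X :: "complex poly mat"
    by (rule eq_matI) (auto simp: to_fract_hom.hom_uminus)
  have ad: "map_mat to_fract (X + Z) = map_mat to_fract X + map_mat to_fract Z"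
    if "X \<in> carrier_mat q q" "Z \<in> carrier_mat q q" for X Z :: "complex poly mat"
    using that by (intro eq_matI) (auto simp: to_fract_hom.hom_add)
  have ze: "map_mat to_fract (0\<^sub>m p s) = (0\<^sub>m p s :: complex poly fract mat)"
    by (rule eq_matI) auto
  show ?thesis
    using assms unfolding unimodular_completion_def
    by (auto simp: to_fract_hom.mat_hom_mult[symmetric, of _ p q] to_fract_hom.mat_hom_mult[symmetric, of _ s q]
        to_fract_hom.mat_hom_mult[symmetric, of _ q s] to_fract_hom.mat_hom_mult[symmetric, of _ q p]
        to_fract_hom.mat_hom_one ad um ze mult_carrier_mat[of _ q p])
qed

locale poly_block_pencil = block_pencil p1 q1 s1 p2 q2 s2 K1 E1 Y1 L1 K2 E2 Y2 L2 M A B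
  for p1 q1 s1 p2 q2 s2 :: nat and K1 E1 Y1 L1 K2 E2 Y2 L2 M A B :: "complex poly mat"
begin

sublocale fract: block_pencil p1 q1 s1 p2 q2 s2
  "map_mat to_fract K1" "map_mat to_fract E1" "map_mat to_fract Y1" "map_mat to_fract L1"
  "map_mat to_fract K2" "map_mat to_fract E2" "map_mat to_fract Y2" "map_mat to_fract L2"
  "map_mat to_fract M" "map_mat to_fract A" "map_mat to_fract B"
  by unfold_locales
    (use completion1 completion2 in \<open>simp_all add: unimodular_completion_to_fract\<close>)

text \<open>With its analogues for \<open>reduced\<close> and \<open>lift\<close>, this lets the
  kernel identities of the instance \<open>fract\<close> be applied to the nullspaces of the
  polynomial matrices.\<close>

lemma map_pencil: "map_mat to_fract pencil = fract.pencil"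
proof -
  have AK: "A * K1 \<in> carrier_mat q2 q1" and KB: "K2\<^sup>T * B \<in> carrier_mat q2 q1"
    using dims by (auto intro: mult_carrier_mat[of _ _ p1] mult_carrier_mat[of _ _ p2])
  have "map_mat to_fract (M + A * K1 + K2\<^sup>T * B) =
      map_mat to_fract M + map_mat to_fract A * map_mat to_fract K1 +
      (map_mat to_fract K2)\<^sup>T * map_mat to_fract B"
    using AK KB to_fract_hom.mat_hom_mult[of A q2 p1 K1 q1] to_fract_hom.mat_hom_mult[of "K2\<^sup>T" q2 p2 B q1]
    by (simp add: map_to_fract_add[of _ q2 q1] map_to_fract_transpose)
  moreover have "map_mat to_fract pencil = four_block_mat (map_mat to_fract (M + A * K1 + K2\<^sup>T * B))
      (map_mat to_fract (K2\<^sup>T)) (map_mat to_fract K1) (map_mat to_fract (0\<^sub>m p1 p2))"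
    unfolding pencil_def
    by (rule map_four_block_mat[of _ q2 q1 _ p2 _ p1])
      (use AK KB in simp_all)
  ultimately show ?thesis
    unfolding fract.pencil_def by (simp add: map_to_fract_zero map_to_fract_transpose)
qed

lemma map_reduced: "map_mat to_fract reduced = fract.reduced"
proof -
  have "M * L1 \<in> carrier_mat q2 s1"
    by (rule mult_carrier_mat[of _ _ q1]) simp_all
  then show ?thesis
    unfolding reduced_def fract.reduced_def
    by (simp add: to_fract_hom.mat_hom_mult[of _ s2 q2 _ s1]
        to_fract_hom.mat_hom_mult[of _ q2 q1 _ s1] map_to_fract_transpose)
qed

lemma map_lift: "map_mat to_fract lift = fract.lift"
proof -
  have YM: "Y2\<^sup>T * M \<in> carrier_mat p2 q1"
    by (rule mult_carrier_mat[of _ _ q2]) simp_all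
  then have diff: "Y2\<^sup>T * M - B \<in> carrier_mat p2 q1" by (simp add: minus_carrier_mat)
  then have "map_mat to_fract ((Y2\<^sup>T * M - B) * L1) =
      ((map_mat to_fract Y2)\<^sup>T * map_mat to_fract M - map_mat to_fract B) * map_mat to_fract L1"
    using YM by (simp add: to_fract_hom.mat_hom_mult[of _ p2 q1 _ s1]
        to_fract_hom.mat_hom_mult[of _ p2 q2 _ q1] map_to_fract_minus[of _ p2 q1] map_to_fract_transpose)
  moreover have "map_mat to_fract lift =
      map_mat to_fract L1 @\<^sub>r map_mat to_fract ((Y2\<^sup>T * M - B) * L1)"
    unfolding lift_def append_rows_def
    by (subst map_four_block_mat[of _ q1 s1 _ 0 _ p2])
      (use YM in \<open>simp_all add: map_to_fract_zero mult_carrier_mat[OF diff]\<close>)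
  ultimately show ?thesis unfolding fract.lift_def by simp
qed

end

section \<open>Block bidiagonal matrices\<close>

lemma sum_lessThan_mult:
  fixes f :: "nat \<Rightarrow> 'a :: comm_monoid_add"
  shows "(\<Sum>i<r * s. f i) = (\<Sum>a<r. \<Sum>j<s. f (a * s + j))"
proof -
  have "(\<Sum>j<s. f (a * s + j)) = (\<Sum>i = a * s..<a * s + s. f i)" for a
    using sum.shift_bounds_nat_ivl[of f 0 "a * s" s]
    by (simp add: atLeast0LessThan add.commute)
  then show ?thesis
    by (simp add: sum.nat_group)
qed

text \<open>The Kronecker product of \<open>X\<close> with the identity matrix of size \<open>s\<close>.\<close>

definition kron_one :: "nat \<Rightarrow> 'a :: comm_ring_1 mat \<Rightarrow> 'a mat" where
  "kron_one s X = mat (dim_row X * s) (dim_col X * s)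
     (\<lambda>(i, j). if i mod s = j mod s then X $$ (i div s, j div s) else 0)"

lemma kron_one_carrier [simp]: "X \<in> carrier_mat r c \<Longrightarrow> kron_one s X \<in> carrier_mat (r * s) (c * s)"
  by (simp add: kron_one_def)

lemma kron_one_mult:
  assumes "X \<in> carrier_mat r c" "Y \<in> carrier_mat c d"
  shows "kron_one s (X * Y) = kron_one s X * kron_one s Y"
proof (rule eq_matI; (use assms in \<open>simp add: kron_one_def; fail\<close>)?)
  fix i j assume "i < dim_row (kron_one s X * kron_one s Y)" "j < dim_col (kron_one s X * kron_one s Y)"
  then have ij: "i < r * s" "j < d * s" using assms by (simp_all add: kron_one_def)
  then have s: "s > 0" by (cases s) auto
  have div: "i div s < r" "j div s < d"
    using ij s by (simp_all add: less_mult_imp_div_less)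
  have "(kron_one s X * kron_one s Y) $$ (i, j) =
      (\<Sum>k<c * s. (if i mod s = k mod s then X $$ (i div s, k div s) else 0) *
        (if k mod s = j mod s then Y $$ (k div s, j div s) else 0))"
    using assms ij by (simp add: kron_one_def scalar_prod_def atLeast0LessThan)
  \<comment> \<open>The summation index is split as \<open>b * s + l\<close>; only the offset
    \<open>l = i mod s\<close> contributes, which leaves the ordinary matrix product over
    \<open>b\<close>.\<close>
  also have "\<dots> = (\<Sum>b<c. \<Sum>l<s. if l = i mod s then
      if i mod s = j mod s then X $$ (i div s, b) * Y $$ (b, j div s) else 0 else 0)"
    unfolding sum_lessThan_mult using s by (intro sum.cong) auto
  also have "\<dots> = (\<Sum>b<c. if i mod s = j mod s then X $$ (i div s, b) * Y $$ (b, j div s) else 0)"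
    using s by simp
  also have "\<dots> = kron_one s (X * Y) $$ (i, j)"
    using assms ij div by (auto simp: kron_one_def scalar_prod_def atLeast0LessThan)
  finally show "kron_one s (X * Y) $$ (i, j) = (kron_one s X * kron_one s Y) $$ (i, j)" ..
qed

lemma kron_one_one: "kron_one s (1\<^sub>m r) = 1\<^sub>m (r * s)"
  by (rule eq_matI) (auto simp: kron_one_def less_mult_imp_div_less, metis div_mult_mod_eq)

lemma kron_one_zero: "kron_one s (0\<^sub>m r c) = 0\<^sub>m (r * s) (c * s)"
  by (rule eq_matI) (auto simp: kron_one_def less_mult_imp_div_less)

lemma kron_one_uminus: "kron_one s (- X) = - kron_one s X"
  by (rule eq_matI) (auto simp: kron_one_def less_mult_imp_div_less)

lemma kron_one_add:
  "X \<in> carrier_mat r c \<Longrightarrow> Y \<in> carrier_mat r c \<Longrightarrow> kron_one s (X + Y) = kron_one s X + kron_one s Y"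
  by (rule eq_matI) (auto simp: kron_one_def less_mult_imp_div_less)

lemma map_mat_kron_one: "f 0 = 0 \<Longrightarrow> map_mat f (kron_one s X) = kron_one s (map_mat f X)"
  by (rule eq_matI) (auto simp: kron_one_def less_mult_imp_div_less)

lemma unimodular_completion_kron_one:
  assumes "unimodular_completion p q t K E Y L"
  shows "unimodular_completion (p * s) (q * s) (t * s) (kron_one s K) (kron_one s E) (kron_one s Y) (kron_one s L)"
  using assms unfolding unimodular_completion_def
  by (auto simp: kron_one_mult[of _ p q, symmetric] kron_one_mult[of _ t q, symmetric]
      kron_one_mult[of _ q t, symmetric] kron_one_mult[of _ q p, symmetric]
      kron_one_one kron_one_zero kron_one_uminus kron_one_add[of _ q q, symmetric]
      simp flip: kron_one_one)

section \<open>The bidiagonal matrix and its explicit completion\<close>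

definition bidiag_K :: "(nat \<Rightarrow> 'a :: comm_ring_1) \<Rightarrow> nat \<Rightarrow> 'a mat" where
  "bidiag_K g r = mat r (r + 1) (\<lambda>(a, b). if b = a then - 1 else if b = a + 1 then g a else 0)"

definition bidiag_E :: "nat \<Rightarrow> 'a :: comm_ring_1 mat" where
  "bidiag_E r = mat 1 (r + 1) (\<lambda>(a, b). if b = r then 1 else 0)"

text \<open>The first \<open>r\<close> rows form the inverse of the negated leading square block of
  \<open>bidiag_K\<close>, that is, a terminating Neumann series; the last row is zero.\<close>

definition bidiag_Y :: "(nat \<Rightarrow> 'a :: comm_ring_1) \<Rightarrow> nat \<Rightarrow> 'a mat" where
  "bidiag_Y g r = mat (r + 1) r (\<lambda>(a, b). if a \<le> b then \<Prod>l=a..<b. g l else 0)"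

text \<open>The kernel vector of \<open>bidiag_K\<close> obtained by back substitution from a last
  entry equal to 1, the empty product.\<close>

definition bidiag_L :: "(nat \<Rightarrow> 'a :: comm_ring_1) \<Rightarrow> nat \<Rightarrow> 'a mat" where
  "bidiag_L g r = mat (r + 1) 1 (\<lambda>(a, b). \<Prod>l=a..<r. g l)"

text \<open>Rows and columns of \<open>bidiag_K\<close> have at most two nonzero entries, so every
  product with it collapses to a two-term expression. The products of consecutive \<open>g l\<close>
  then cancel by splitting off their first or last factor.\<close>

lemma unimodular_completion_bidiag:
  "unimodular_completion r (r + 1) 1 (bidiag_K g r) (bidiag_E r) (bidiag_Y g r) (bidiag_L g r)"
proof -
  have K1: "(\<Sum>b<r + 1. (if b = a then - 1 else if b = a + 1 then g a else 0) * h b) = g a * h (a + 1) - h a"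
    if "a < r" for a h
  proof -
    have "(if b = a then - 1 else if b = a + 1 then g a else 0) * h b =
        (if b = a + 1 then g a * h b else 0) - (if b = a then h b else 0)" for b
      by simp
    then show ?thesis using that by (simp add: sum_subtractf)
  qed
  have K2: "(\<Sum>c<r. h c * (if b = c then - 1 else if b = c + 1 then g c else 0)) =
      (if b = 0 then 0 else h (b - 1) * g (b - 1)) - (if b < r then h b else 0)"
    if "b < r + 1" for b h
  proof -
    \<comment> \<open>For \<open>b = 0\<close> the truncated \<open>b - 1\<close> is 0 again, so the
      inner test must discard a superdiagonal entry that does not exist.\<close>
    have "h c * (if b = c then - 1 else if b = c + 1 then g c else 0) =
        (if c = b - 1 then if b = 0 then 0 else h c * g c else 0) - (if c = b then h c else 0)" for c
      by auto
    then show ?thesis using that by (simp add: sum_subtractf) arith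
  qed
  have prod_head: "(\<Prod>l=a..<b. g l) = g a * (\<Prod>l=Suc a..<b. g l)" if "a < b" for a b
    using that by (rule prod.atLeast_Suc_lessThan)
  have prod_last: "(\<Prod>l=a..<b. g l) = (\<Prod>l=a..<b - 1. g l) * g (b - 1)" if "a < b" for a b
    using that by (cases b) auto
  have "bidiag_K g r * bidiag_Y g r = - 1\<^sub>m r"
  proof (rule eq_matI)
    fix a b assume "a < dim_row (- 1\<^sub>m r :: 'a mat)" "b < dim_col (- 1\<^sub>m r :: 'a mat)"
    then have ab: "a < r" "b < r" by simp_all
    then have "(bidiag_K g r * bidiag_Y g r) $$ (a, b) =
       (\<Sum>c<r + 1. (if c = a then - 1 else if c = a + 1 then g a else 0) *
         (if c \<le> b then \<Prod>l=c..<b. g l else 0))"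
      by (simp add: bidiag_K_def bidiag_Y_def scalar_prod_def atLeast0LessThan del: sum.lessThan_Suc)
    also have "\<dots> = (- 1\<^sub>m r) $$ (a, b)"
      using ab by (subst K1) (auto simp: prod_head)
    finally show "(bidiag_K g r * bidiag_Y g r) $$ (a, b) = (- 1\<^sub>m r) $$ (a, b)" .
  qed (simp_all add: bidiag_K_def bidiag_Y_def)
  moreover have "bidiag_K g r * bidiag_L g r = 0\<^sub>m r 1"
  proof (rule eq_matI)
    fix a b assume "a < dim_row (0\<^sub>m r 1 :: 'a mat)" "b < dim_col (0\<^sub>m r 1 :: 'a mat)"
    then have ab: "a < r" "b = 0" by simp_all
    then have "(bidiag_K g r * bidiag_L g r) $$ (a, b) =
       (\<Sum>c<r + 1. (if c = a then - 1 else if c = a + 1 then g a else 0) * (\<Prod>l=c..<r. g l))"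
      by (simp add: bidiag_K_def bidiag_L_def scalar_prod_def atLeast0LessThan del: sum.lessThan_Suc)
    also have "\<dots> = 0\<^sub>m r 1 $$ (a, b)"
      using ab by (subst K1) (auto simp: prod_head)
    finally show "(bidiag_K g r * bidiag_L g r) $$ (a, b) = 0\<^sub>m r 1 $$ (a, b)" .
  qed (simp_all add: bidiag_K_def bidiag_L_def)
  moreover have "bidiag_E r * bidiag_L g r = 1\<^sub>m 1"
    by (rule eq_matI) (auto simp: bidiag_E_def bidiag_L_def scalar_prod_def atLeast0LessThan)
  moreover have "bidiag_L g r * bidiag_E r = 1\<^sub>m (r + 1) + bidiag_Y g r * bidiag_K g r"
  proof (rule eq_matI)
    fix a b assume "a < dim_row (1\<^sub>m (r + 1) + bidiag_Y g r * bidiag_K g r)"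
      "b < dim_col (1\<^sub>m (r + 1) + bidiag_Y g r * bidiag_K g r)"
    then have ab: "a < r + 1" "b < r + 1" by (simp_all add: bidiag_K_def bidiag_Y_def)
    then have "(bidiag_Y g r * bidiag_K g r) $$ (a, b) =
       (\<Sum>c<r. (if a \<le> c then \<Prod>l=a..<c. g l else 0) *
         (if b = c then - 1 else if b = c + 1 then g c else 0))"
      by (simp add: bidiag_K_def bidiag_Y_def scalar_prod_def atLeast0LessThan)
    also have "\<dots> = (if b = r then \<Prod>l=a..<r. g l else 0) - (if a = b then 1 else 0)"
      using ab prod_last[of a b] by (subst K2) auto
    finally have "(bidiag_Y g r * bidiag_K g r) $$ (a, b) =
      (if b = r then \<Prod>l=a..<r. g l else 0) - (if a = b then 1 else 0)" .
    then show "(bidiag_L g r * bidiag_E r) $$ (a, b) = (1\<^sub>m (r + 1) + bidiag_Y g r * bidiag_K g r) $$ (a, b)"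
      using ab by (simp add: bidiag_K_def bidiag_Y_def bidiag_L_def bidiag_E_def scalar_prod_def)
  qed (simp_all add: bidiag_K_def bidiag_Y_def bidiag_L_def bidiag_E_def)
  ultimately show ?thesis
    by (simp add: unimodular_completion_def bidiag_K_def bidiag_Y_def bidiag_L_def bidiag_E_def)
qed

section \<open>Degrees of vector polynomials\<close>

lemma vec_degree_le_iff: "vec_degree v \<le> d \<longleftrightarrow> (\<forall>i<dim_vec v. degree (v $ i) \<le> d)"
  by (auto simp: vec_degree_def)

text \<open>Zero entries also have degree 0, so when the vector degree is 0 a nonzero entry is
  chosen; otherwise an entry attaining the maximum is automatically nonzero.\<close>

lemma vec_degree_attained:
  assumes "v \<in> carrier_vec n" "v \<noteq> 0\<^sub>v n"
  obtains i where "i < n" "v $ i \<noteq> 0" "degree (v $ i) = vec_degree v"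
proof (cases "vec_degree v = 0")
  case True
  obtain i where "i < n" "v $ i \<noteq> 0" using assms by (auto simp: vec_eq_iff)
  moreover from True have "degree (v $ i) \<le> 0"
    using assms \<open>i < n\<close> unfolding vec_degree_le_iff[symmetric] by (metis carrier_vecD le_zero_eq vec_degree_le_iff)
  ultimately show ?thesis using that True by simp
next
  case False
  have "vec_degree v \<in> insert 0 {degree (v $ i) | i. i < dim_vec v}"
    unfolding vec_degree_def by (rule Max_in) auto
  with False obtain i where "i < dim_vec v" "degree (v $ i) = vec_degree v" by auto
  with False that assms show ?thesis by fastforce
qed

lemma mult_mat_vec_index_sum:
  fixes A :: "'a :: comm_semiring_0 mat"
  assumes "A \<in> carrier_mat p q" "v \<in> carrier_vec q" "i < p"
  shows "(A *\<^sub>v v) $ i = (\<Sum>j<q. A $$ (i, j) * v $ j)"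
  using assms by (auto simp: scalar_prod_def atLeast0LessThan intro!: sum.cong)

lemma mult_mat_index_sum:
  fixes A B :: "'a :: comm_semiring_0 mat"
  assumes "A \<in> carrier_mat p q" "B \<in> carrier_mat q r" "i < p" "j < r"
  shows "(A * B) $$ (i, j) = (\<Sum>l<q. A $$ (i, l) * B $$ (l, j))"
  using assms by (auto simp: scalar_prod_def atLeast0LessThan intro!: sum.cong)

lemma degree_mult_mat_vec_le:
  fixes A :: "complex poly mat"
  assumes "A \<in> carrier_mat p q" "i < p" "\<And>j. j < q \<Longrightarrow> degree (A $$ (i, j)) = 0"
    and "v \<in> carrier_vec q" "\<And>j. j < q \<Longrightarrow> degree (v $ j) \<le> d"
  shows "degree ((A *\<^sub>v v) $ i) \<le> d"
  using assms(3,5) unfolding mult_mat_vec_index_sum[OF assms(1,4,2)]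
  by (intro degree_sum_le order.trans[OF degree_mult_le]) auto

lemma degree_prod_linear:
  fixes g :: "nat \<Rightarrow> complex poly"
  assumes "\<And>a. degree (g a) = 1"
  shows "degree (\<Prod>l=a..<r. g l) = r - a" "(\<Prod>l=a..<r. g l) \<noteq> 0"
proof -
  have nz: "g a \<noteq> 0" for a using assms[of a] by auto
  then show "(\<Prod>l=a..<r. g l) \<noteq> 0" by simp
  show "degree (\<Prod>l=a..<r. g l) = r - a"
    using nz assms by (subst degree_prod_eq_sum_degree) auto
qed

section \<open>Blockwise action of the bidiagonal factors\<close>

lemma kron_bidiag_L_mult_vec:
  assumes "v \<in> carrier_vec s" "i < (r + 1) * s"
  shows "(kron_one s (bidiag_L g r) *\<^sub>v v) $ i = (\<Prod>l=i div s..<r. g l) * v $ (i mod s)"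
proof -
  have s: "s > 0" using assms(2) by (cases s) auto
  have "i div s < r + 1" using assms(2) by (rule less_mult_imp_div_less)
  then have "kron_one s (bidiag_L g r) $$ (i, j) * v $ j =
      (if j = i mod s then (\<Prod>l=i div s..<r. g l) * v $ j else 0)" if "j < s" for j
    using that assms(2) by (simp add: kron_one_def bidiag_L_def)
  moreover have L: "kron_one s (bidiag_L g r) \<in> carrier_mat ((r + 1) * s) s"
    by (simp add: kron_one_def bidiag_L_def)
  ultimately show ?thesis
    using s unfolding mult_mat_vec_index_sum[OF L assms] by simp
qed

text \<open>Identifies the abstract coordinate map with the extraction of the last block, numbered
  \<open>r\<close> when counting from 0.\<close>

lemma kron_bidiag_E_mult_vec:
  assumes "u \<in> carrier_vec ((r + 1) * s)"
  shows "kron_one s (bidiag_E r) *\<^sub>v u = vec_block s r u"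
proof (rule eq_vecI)
  fix i assume "i < dim_vec (vec_block s r u)"
  then have i: "i < s" by (simp add: vec_block_def)
  have E: "kron_one s (bidiag_E r) \<in> carrier_mat s ((r + 1) * s)"
    by (simp add: kron_one_def bidiag_E_def)
  have "kron_one s (bidiag_E r) $$ (i, b * s + l) * u $ (b * s + l) =
      (if l = i then if b = r then u $ (b * s + l) else 0 else 0)"
    if bl: "b < r + 1" "l < s" for b l
  proof -
    have "b * s + l < (b + 1) * s" using bl by simp
    also have "\<dots> \<le> (r + 1) * s" using bl by (intro mult_le_mono1) simp
    finally show ?thesis
      using bl i by (simp add: kron_one_def bidiag_E_def)
  qed
  then show "(kron_one s (bidiag_E r) *\<^sub>v u) $ i = vec_block s r u $ i"
    using i unfolding mult_mat_vec_index_sum[OF E assms i] sum_lessThan_mult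
    by (simp add: vec_block_def)
qed (simp add: kron_one_def bidiag_E_def vec_block_def)

text \<open>Index \<open>i + s\<close> lies one block below \<open>i\<close>, so this describes the
  block rows after the first. Each couples two consecutive blocks of \<open>w\<close>, except the
  last one, where the diagonal entry is missing; back substitution starts there.\<close>

lemma kron_bidiag_K_transpose_mult_vec:
  assumes "w \<in> carrier_vec (r * s)" "i < r * s"
  shows "((kron_one s (bidiag_K g r))\<^sup>T *\<^sub>v w) $ (i + s) =
    g (i div s) * w $ i - (if i + s < r * s then w $ (i + s) else 0)"
proof -
  have s: "s > 0" using assms(2) by (cases s) auto
  have entry: "kron_one s (bidiag_K g r) $$ (k, i + s) =
      (if k = i then g (i div s) else 0) - (if k = i + s then 1 else 0)" if "k < r * s" for k
  proof -
    have "k div s < r" "(i + s) div s = i div s + 1" "i div s < r"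
      using that assms(2) s by (simp_all add: less_mult_imp_div_less)
    moreover have "k = i \<longleftrightarrow> k div s = i div s \<and> k mod s = i mod s"
      "k = i + s \<longleftrightarrow> k div s = i div s + 1 \<and> k mod s = i mod s"
      using s by (metis div_mult_mod_eq, metis div_mult_mod_eq div_add_self2 mod_add_self2 Suc_eq_plus1 neq0_conv)
    ultimately show ?thesis
      using that assms(2) by (auto simp: kron_one_def bidiag_K_def)
  qed
  have K: "(kron_one s (bidiag_K g r))\<^sup>T \<in> carrier_mat ((r + 1) * s) (r * s)"
    by (simp add: kron_one_def bidiag_K_def)
  have "((kron_one s (bidiag_K g r))\<^sup>T *\<^sub>v w) $ (i + s) =
      (\<Sum>k<r * s. (kron_one s (bidiag_K g r))\<^sup>T $$ (i + s, k) * w $ k)"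
    using assms by (intro mult_mat_vec_index_sum[OF K]) auto
  also have "\<dots> = (\<Sum>k<r * s. (if k = i then g (i div s) * w $ k else 0) - (if k = i + s then w $ k else 0))"
    using assms(2) K carrier_matD[OF K] by (intro sum.cong refl) (simp add: entry left_diff_distrib)
  also have "\<dots> = g (i div s) * w $ i - (if i + s < r * s then w $ (i + s) else 0)"
    using assms(2) by (simp add: sum_subtractf)
  finally show ?thesis .
qed

text \<open>Back substitution: the first block row of the system is not needed.\<close>

lemma degree_bidiag_solution:
  fixes g :: "nat \<Rightarrow> complex poly"
  assumes g: "\<And>a. degree (g a) = 1"
    and w: "w \<in> carrier_vec (r * s)" and eq: "(kron_one s (bidiag_K g r))\<^sup>T *\<^sub>v w = - h"
    and h: "h \<in> carrier_vec ((r + 1) * s)"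
    and deg: "\<And>i. s \<le> i \<Longrightarrow> i < (r + 1) * s \<Longrightarrow> degree (h $ i) \<le> d"
    and "i < r * s"
  shows "degree (w $ i) \<le> d"
  using \<open>i < r * s\<close>
\<comment> \<open>The induction runs on the distance to the end, so the entry one block further down
  is already bounded.\<close>
proof (induction "r * s - i" arbitrary: i rule: less_induct)
  case less
  then have s: "s > 0" by (cases s) auto
  have "((kron_one s (bidiag_K g r))\<^sup>T *\<^sub>v w) $ (i + s) = - h $ (i + s)"
    using less.prems h by (simp add: eq)
  then have "g (i div s) * w $ i = (if i + s < r * s then w $ (i + s) else 0) - h $ (i + s)"
    unfolding kron_bidiag_K_transpose_mult_vec[OF w less.prems] by (simp add: algebra_simps)
  moreover have "degree (if i + s < r * s then w $ (i + s) else 0) \<le> d"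
    using less s by auto
  ultimately have "degree (g (i div s) * w $ i) \<le> d"
    using deg[of "i + s"] less.prems by (auto intro!: degree_diff_le)
  \<comment> \<open>Cancelling a nonzero factor cannot raise the degree, so the bound passes from
    the product to \<open>w $ i\<close>.\<close>
  moreover have "g (i div s) \<noteq> 0" using g[of "i div s"] by auto
  ultimately show ?case
    using g by (cases "w $ i = 0") (auto simp: degree_mult_eq)
qed

text \<open>The first block row of \<open>M\<close> is exempt from the degree condition because it
  contains the corner block with a linear factor. The two sides are parametrized alike, so the
  transposed pencil is an instance as well.\<close>

locale bidiag_pencil =
  fixes s1 r1 p1 q1 s2 r2 p2 q2 :: nat and g1 g2 :: "nat \<Rightarrow> complex poly" and M A B :: "complex poly mat"
  assumes degree_g1: "degree (g1 a) = 1" and degree_g2: "degree (g2 a) = 1"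
    and p1: "p1 = r1 * s1" and q1: "q1 = (r1 + 1) * s1"
    and p2: "p2 = r2 * s2" and q2: "q2 = (r2 + 1) * s2"
    and M_carrier: "M \<in> carrier_mat q2 q1"
    and A_carrier: "A \<in> carrier_mat q2 p1"
    and B_carrier: "B \<in> carrier_mat p2 q1"
    and degree_M: "s2 \<le> i \<Longrightarrow> i < q2 \<Longrightarrow> j < q1 \<Longrightarrow> degree (M $$ (i, j)) = 0"
    and degree_B: "i < p2 \<Longrightarrow> j < q1 \<Longrightarrow> degree (B $$ (i, j)) = 0"
begin

abbreviation "K1 \<equiv> kron_one s1 (bidiag_K g1 r1)"
abbreviation "E1 \<equiv> kron_one s1 (bidiag_E r1) :: complex poly mat"
abbreviation "Y1 \<equiv> kron_one s1 (bidiag_Y g1 r1)"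
abbreviation "L1 \<equiv> kron_one s1 (bidiag_L g1 r1)"
abbreviation "K2 \<equiv> kron_one s2 (bidiag_K g2 r2)"
abbreviation "E2 \<equiv> kron_one s2 (bidiag_E r2) :: complex poly mat"
abbreviation "Y2 \<equiv> kron_one s2 (bidiag_Y g2 r2)"
abbreviation "L2 \<equiv> kron_one s2 (bidiag_L g2 r2)"

sublocale poly_block_pencil p1 q1 s1 p2 q2 s2 K1 E1 Y1 L1 K2 E2 Y2 L2 M A B
  by unfold_locales
    (rule unimodular_completion_kron_one[OF unimodular_completion_bidiag[of r1 g1], of s1, unfolded mult_1, folded p1 q1]
      unimodular_completion_kron_one[OF unimodular_completion_bidiag[of r2 g2], of s2, unfolded mult_1, folded p2 q2]
      M_carrier A_carrier B_carrier)+

lemma vec_degree_lift: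
  assumes y: "y \<in> carrier_vec s1" "y \<noteq> 0\<^sub>v s1" "reduced *\<^sub>v y = 0\<^sub>v s2"
  shows "vec_degree (lift *\<^sub>v y) = vec_degree y + r1"
proof (rule antisym)
  define u where "u = L1 *\<^sub>v y"
  define w where "w = Y2\<^sup>T *\<^sub>v (M *\<^sub>v u)"
  have u: "u \<in> carrier_vec q1" unfolding u_def using y(1) by simp
  then have w: "w \<in> carrier_vec p2" unfolding w_def by simp
  have lift_y: "lift *\<^sub>v y = u @\<^sub>v (w - B *\<^sub>v u)"
    using lift_mult_vec[OF y(1)] by (simp add: u_def w_def)
  have u_index: "u $ i = (\<Prod>l=i div s1..<r1. g1 l) * y $ (i mod s1)" if "i < q1" for i
    unfolding u_def using that by (intro kron_bidiag_L_mult_vec[OF y(1)]) (simp add: q1)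
  have deg_u: "degree (u $ i) \<le> vec_degree y + r1" if "i < q1" for i
  proof -
    have "i mod s1 < s1" using that by (cases s1) (auto simp: q1)
    then have "degree (y $ (i mod s1)) \<le> vec_degree y"
      using y(1) vec_degree_le_iff[of y] by auto
    moreover have "degree (\<Prod>l=i div s1..<r1. g1 l) \<le> r1"
      using degree_prod_linear(1)[of g1, OF degree_g1] by simp
    ultimately show ?thesis
      unfolding u_index[OF that] using degree_mult_le[of "\<Prod>l=i div s1..<r1. g1 l" "y $ (i mod s1)"]
      by linarith
  qed
  have deg_w: "degree (w $ i) \<le> vec_degree y + r1" if "i < p2" for i
  \<comment> \<open>After the first block row \<open>M\<close> is constant, so there
    \<open>M u\<close> inherits the degree bound of \<open>u\<close>, and the solution
    \<open>w\<close> inherits it in turn.\<close>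
  proof (rule degree_bidiag_solution[OF degree_g2 w[unfolded p2] _ _ _ that[unfolded p2]])
    show "K2\<^sup>T *\<^sub>v w = - (M *\<^sub>v u)"
      unfolding w_def u_def by (rule K2_Y2_M_L1_vec[OF y(1,3)])
    show "M *\<^sub>v u \<in> carrier_vec ((r2 + 1) * s2)" using u unfolding q2[symmetric] by simp
    fix i assume "s2 \<le> i" "i < (r2 + 1) * s2"
    then have "s2 \<le> i" "i < q2" by (simp_all add: q2)
    then show "degree ((M *\<^sub>v u) $ i) \<le> vec_degree y + r1"
      using degree_M u deg_u by (intro degree_mult_mat_vec_le[OF M]) auto
  qed
  have "degree ((B *\<^sub>v u) $ i) \<le> vec_degree y + r1" if "i < p2" for i
    using degree_B u deg_u that by (intro degree_mult_mat_vec_le[OF B]) auto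
  then show "vec_degree (lift *\<^sub>v y) \<le> vec_degree y + r1"
    unfolding lift_y vec_degree_le_iff using u w deg_u deg_w by (auto intro!: degree_diff_le)
  \<comment> \<open>For the lower bound, a nonzero entry of \<open>y\<close> of maximal degree is
    followed into the first block of \<open>u\<close>, where it is multiplied by all
    \<open>r1\<close> linear factors.\<close>
  obtain i where i: "i < s1" "y $ i \<noteq> 0" "degree (y $ i) = vec_degree y"
    using vec_degree_attained[OF y(1,2)] .
  then have iq: "i < q1" by (simp add: q1)
  with i have "degree (u $ i) = vec_degree y + r1"
    by (simp add: u_index degree_mult_eq[OF degree_prod_linear(2)] degree_prod_linear(1) degree_g1)
  moreover have "(lift *\<^sub>v y) $ i = u $ i"
    using iq u w unfolding lift_y by simp
  moreover have "i < dim_vec (lift *\<^sub>v y)"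
    using iq u unfolding lift_y by simp
  ultimately show "vec_degree y + r1 \<le> vec_degree (lift *\<^sub>v y)"
    using vec_degree_le_iff[of "lift *\<^sub>v y" "vec_degree (lift *\<^sub>v y)"] by auto
qed

text \<open>Block \<open>r1\<close> of \<open>z\<close> is the last block of its first part
  \<open>u\<close>, hence equals \<open>E1\<close> applied to \<open>u\<close>; the abstract
  description of the kernel then applies.\<close>

lemma fract_kernel:
  assumes "z \<in> right_nullspace pencil"
  shows "vec_block s1 r1 z \<in> right_nullspace reduced"
    and "map_mat to_fract lift *\<^sub>v vec_block s1 r1 z = z"
proof -
  define u v where "u = vec_first z q1" and "v = vec_last z p2"
  have z: "z \<in> carrier_vec (q1 + p2)" "fract.pencil *\<^sub>v z = 0\<^sub>v (q2 + p1)"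
    using assms pencil_carrier
    by (auto simp: right_nullspace_def mat_kernel_def map_pencil[symmetric])
  have uv: "u \<in> carrier_vec q1" "v \<in> carrier_vec p2" "u @\<^sub>v v = z"
    using z(1) by (simp_all add: u_def v_def)
  have "map_mat to_fract E1 = kron_one s1 (bidiag_E r1)"
    by (subst map_mat_kron_one) (auto simp: bidiag_E_def intro!: arg_cong[of _ _ "kron_one s1"] eq_matI)
  then have "map_mat to_fract E1 *\<^sub>v u = vec_block s1 r1 u"
    using kron_bidiag_E_mult_vec uv(1) by (simp add: q1)
  also have "\<dots> = vec_block s1 r1 z"
    using z(1) by (intro eq_vecI) (auto simp: u_def vec_block_def vec_first_def q1)
  finally have E1u: "map_mat to_fract E1 *\<^sub>v u = vec_block s1 r1 z" .
  have "fract.pencil *\<^sub>v (u @\<^sub>v v) = 0\<^sub>v (q2 + p1)" using z(2) uv(3) by simp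
  note ker = fract.pencil_kernel[OF uv(1,2) this]
  show "map_mat to_fract lift *\<^sub>v vec_block s1 r1 z = z"
    using ker(2) unfolding E1u uv(3) map_lift .
  show "vec_block s1 r1 z \<in> right_nullspace reduced"
    using ker(1) reduced_carrier unfolding E1u
    by (auto simp: right_nullspace_def mat_kernel_def map_reduced[symmetric] vec_block_def)
qed

lemma fract_lift:
  assumes "y \<in> right_nullspace reduced"
  shows "map_mat to_fract lift *\<^sub>v y \<in> right_nullspace pencil"
    and "vec_block s1 r1 (map_mat to_fract lift *\<^sub>v y) = y"
proof -
  have y: "y \<in> carrier_vec s1" "fract.reduced *\<^sub>v y = 0\<^sub>v s2"
    using assms reduced_carrier by (auto simp: right_nullspace_def mat_kernel_def map_reduced[symmetric])
  then show ker: "map_mat to_fract lift *\<^sub>v y \<in> right_nullspace pencil"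
    using fract.pencil_mult_lift[OF y] fract.pencil_carrier fract.lift_carrier
    by (auto simp: right_nullspace_def mat_kernel_def map_pencil map_lift)
  have L1: "map_mat to_fract L1 = kron_one s1 (bidiag_L (\<lambda>l. to_fract (g1 l)) r1)"
    by (subst map_mat_kron_one)
      (auto simp: bidiag_L_def to_fract_hom.hom_prod intro!: arg_cong[of _ _ "kron_one s1"] eq_matI)
  show "vec_block s1 r1 (map_mat to_fract lift *\<^sub>v y) = y"
  proof (rule eq_vecI)
    fix i assume "i < dim_vec y"
    then have i: "i < s1" using y(1) by simp
    then have lt: "r1 * s1 + i < (r1 + 1) * s1" by simp
    \<comment> \<open>In block \<open>r1\<close> the product of linear factors is empty, so
      \<open>L1\<close> reproduces \<open>y\<close> there.\<close>
    then have "(map_mat to_fract L1 *\<^sub>v y) $ (r1 * s1 + i) = y $ i"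
      using i by (subst L1, subst kron_bidiag_L_mult_vec[OF y(1)]) auto
    then show "vec_block s1 r1 (map_mat to_fract lift *\<^sub>v y) $ i = y $ i"
      using i y(1) lt fract.lift_mult_vec[OF y(1)] unfolding q1[symmetric]
      by (simp add: map_lift vec_block_def)
  qed (use y(1) in \<open>simp add: vec_block_def\<close>)
qed

lemma minimal_basis_reduced:
  assumes "minimal_basis (q1 + p2) (right_nullspace pencil) zs"
  shows "minimal_basis s1 (right_nullspace reduced) (map (vec_block s1 r1) zs) \<and>
    (\<forall>z\<in>set zs. vec_degree z = vec_degree (vec_block s1 r1 z) + r1)"
proof -
  \<comment> \<open>Block \<open>r1\<close> lies inside vectors of length \<open>q1 + p2\<close>;
    with these bounds \<open>vec_block\<close> is seen to commute with sums, scalar multiples and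
    the embedding.\<close>
  have "r1 * s1 + i < q1 + p2" if "i < s1" for i
    using that by (simp add: q1)
  note [simp] = this this[unfolded add.commute[of q1]]
  show ?thesis
  proof (rule minimal_basis_iso[OF pencil_carrier reduced_carrier _ _ _ _ lift_carrier _ _ assms])
    show "bij_betw (vec_block s1 r1) (right_nullspace pencil) (right_nullspace reduced)"
      using fract_kernel fract_lift by (intro bij_betw_byWitness[where f' = "(*\<^sub>v) (map_mat to_fract lift)"]) auto
  qed (use fract_lift vec_degree_lift in \<open>auto simp: vec_block_def intro!: eq_vecI\<close>)
qed

end

section \<open>The Newton basis\<close>

lemma degree_node_factor: "degree (node_factor x j) = 1"
  by (simp add: node_factor_def)

lemma newton_K_eq: "newton_K x s r t = kron_one s (bidiag_K (\<lambda>a. node_factor x (t - a)) r)"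
proof (rule eq_matI)
  fix i j assume "i < dim_row (kron_one s (bidiag_K (\<lambda>a. node_factor x (t - a)) r))"
    "j < dim_col (kron_one s (bidiag_K (\<lambda>a. node_factor x (t - a)) r))"
  then have ij: "i < r * s" "j < (r + 1) * s" by (simp_all add: kron_one_def bidiag_K_def)
  then have s: "s > 0" by (cases s) auto
  have "i div s < r" "j div s < r + 1" "i mod s < s" "j mod s < s"
    using ij s less_mult_imp_div_less by (auto simp del: mult_Suc)
  then show "newton_K x s r t $$ (i, j) = kron_one s (bidiag_K (\<lambda>a. node_factor x (t - a)) r) $$ (i, j)"
    using ij by (simp add: newton_K_def blocks_mat_def kron_one_def bidiag_K_def)
qed (simp_all add: newton_K_def blocks_mat_def kron_one_def bidiag_K_def)

text \<open>As \<open>l\<close> runs from \<open>b\<close> to \<open>r - 1\<close>, the node indices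
  descend from \<open>t - b\<close> to \<open>t - r + 1\<close>, exactly the factors missing from
  the smaller Newton polynomial.\<close>

lemma newton_poly_split:
  assumes "b \<le> r" "r \<le> t"
  shows "newton_poly x (t - r) * (\<Prod>l=b..<r. node_factor x (t - l)) = newton_poly x (t - b)"
  using assms(1)
proof (induction rule: inc_induct)
  case (step b)
  have "t - b = Suc (t - Suc b)" using step assms(2) by simp
  then have "newton_poly x (t - b) = newton_poly x (t - Suc b) * node_factor x (t - b)"
    by (simp add: newton_poly_def)
  moreover have "(\<Prod>l=b..<r. node_factor x (t - l)) =
      node_factor x (t - b) * (\<Prod>l=Suc b..<r. node_factor x (t - l))"
    using step by (intro prod.atLeast_Suc_lessThan) simp
  ultimately show ?case
    using step.IH by (simp add: algebra_simps)
qed simp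

text \<open>Separating the term with \<open>P k\<close> leaves one formula for the first block row
  and the last block column, since \<open>k - 1 - a - b = \<mu> - a\<close> when
  \<open>b = k - \<mu> - 1\<close>.\<close>

lemma newton_M_index:
  assumes "\<And>i. i \<le> k \<Longrightarrow> P i \<in> carrier_mat m n" and "\<mu> \<le> k - 1" "k \<ge> 1"
    and "a \<le> \<mu>" "b < k - \<mu>" "i < m" "j < n"
  shows "newton_M m n k \<mu> x P $$ (a * m + i, b * n + j) =
    (if a = 0 \<and> b = 0 then node_factor x k * [:P k $$ (i, j):] else 0) +
    (if a = 0 \<or> b = k - \<mu> - 1 then [:P (k - 1 - a - b) $$ (i, j):] else 0)"
proof -
  have "a * m + i < (a + 1) * m" using assms by simp
  also have "\<dots> \<le> (\<mu> + 1) * m" using assms by (intro mult_le_mono1) simp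
  finally have ai: "a * m + i < (\<mu> + 1) * m" .
  have "b * n + j < (b + 1) * n" using assms by simp
  also have "\<dots> \<le> (k - \<mu>) * n" using assms by (intro mult_le_mono1) simp
  finally have bj: "b * n + j < (k - \<mu>) * n" .
  have car: "P i' \<in> carrier_mat m n" if "i' \<le> k" for i' using assms(1) that .
  have "newton_M m n k \<mu> x P $$ (a * m + i, b * n + j) =
     (if a = 0 \<and> b = 0 then node_factor x k \<cdot>\<^sub>m const_mat (P k) + const_mat (P (k - 1))
     else if a = 0 then const_mat (P (k - 1 - b))
     else if b = k - \<mu> - 1 then const_mat (P (\<mu> - a))
     else 0\<^sub>m m n) $$ (i, j)"
    using ai bj assms(6,7) by (simp add: newton_M_def blocks_mat_def)
  also have "\<dots> = (if a = 0 \<and> b = 0 then node_factor x k * [:P k $$ (i, j):] + [:P (k - 1) $$ (i, j):]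
     else if a = 0 then [:P (k - 1 - b) $$ (i, j):]
     else if b = k - \<mu> - 1 then [:P (\<mu> - a) $$ (i, j):] else 0)"
    using assms(6,7) car[of k, THEN carrier_matD(1)] car[of k, THEN carrier_matD(2)]
      car[of "k - 1", THEN carrier_matD(1)] car[of "k - 1", THEN carrier_matD(2)]
      car[of "k - 1 - b", THEN carrier_matD(1)] car[of "k - 1 - b", THEN carrier_matD(2)]
      car[of "\<mu> - a", THEN carrier_matD(1)] car[of "\<mu> - a", THEN carrier_matD(2)] assms(2,3)
    by simp
  also have "\<dots> = (if a = 0 \<and> b = 0 then node_factor x k * [:P k $$ (i, j):] else 0) +
    (if a = 0 \<or> b = k - \<mu> - 1 then [:P (k - 1 - a - b) $$ (i, j):] else 0)"
  proof (cases "a = 0")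
    case False
    moreover have "k - 1 - a - b = \<mu> - a" if "b = k - \<mu> - 1" using that assms by simp
    ultimately show ?thesis by simp
  qed auto
  finally show ?thesis .
qed

text \<open>Block \<open>(a, b)\<close> is weighted by \<open>p2 a * p1 b\<close>. Along the first
  block row this is the Newton polynomial of index \<open>k - 1 - b\<close>, along the last block
  column that of index \<open>\<mu> - a\<close>; in the corner, the extra node factor raises index
  \<open>k - 1\<close> to \<open>k\<close>.\<close>

lemma newton_matpoly_factorization:
  assumes P: "\<And>i. i \<le> k \<Longrightarrow> P i \<in> carrier_mat m n" and \<mu>: "\<mu> \<le> k - 1" "k \<ge> 1"
  shows "(kron_one m (bidiag_L (\<lambda>a. node_factor x (\<mu> - a)) \<mu>))\<^sup>T *
      (newton_M m n k \<mu> x P * kron_one n (bidiag_L (\<lambda>a. node_factor x (k - 1 - a)) (k - \<mu> - 1))) =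
    newton_matpoly m n k x P"
proof (rule eq_matI)
  define r where "r = k - \<mu> - 1"
  have k: "k = r + (\<mu> + 1)" using \<mu> by (simp add: r_def)
  define p1 where "p1 b = (\<Prod>l=b..<r. node_factor x (k - 1 - l))" for b
  define p2 where "p2 a = (\<Prod>l=a..<\<mu>. node_factor x (\<mu> - l))" for a
  let ?L1 = "kron_one n (bidiag_L (\<lambda>a. node_factor x (k - 1 - a)) r)"
  let ?L2 = "kron_one m (bidiag_L (\<lambda>a. node_factor x (\<mu> - a)) \<mu>)"
  let ?M = "newton_M m n k \<mu> x P"
  have M: "?M \<in> carrier_mat ((\<mu> + 1) * m) ((r + 1) * n)"
    by (simp add: newton_M_def blocks_mat_def k)
  have L1: "?L1 \<in> carrier_mat ((r + 1) * n) n" and L2: "?L2 \<in> carrier_mat ((\<mu> + 1) * m) m"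
    by (simp_all add: kron_one_def bidiag_L_def)
  have L_index: "kron_one s (bidiag_L g t) $$ (b * s + l, j) = (if l = j then \<Prod>l=b..<t. g l else 0)"
    if "b < t + 1" "l < s" "j < s" for s t b l j :: nat and g :: "nat \<Rightarrow> complex poly"
  proof -
    have "b * s + l < (b + 1) * s" using that by simp
    also have "\<dots> \<le> (t + 1) * s" using that by (intro mult_le_mono1) simp
    finally show ?thesis using that by (simp add: kron_one_def bidiag_L_def)
  qed
  fix i j assume "i < dim_row (newton_matpoly m n k x P)" "j < dim_col (newton_matpoly m n k x P)"
  then have ij: "i < m" "j < n" by (simp_all add: newton_matpoly_def)
  define c where "c l = [:P l $$ (i, j):] * newton_poly x l" for l
  have inner: "(?M * ?L1) $$ (a, j) = (\<Sum>b<r + 1. ?M $$ (a, b * n + j) * p1 b)"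
    if "a < (\<mu> + 1) * m" for a
  proof -
    have "(?M * ?L1) $$ (a, j) = (\<Sum>b<(r + 1) * n. ?M $$ (a, b) * ?L1 $$ (b, j))"
      by (rule mult_mat_index_sum[OF M L1 that ij(2)])
    also have "\<dots> = (\<Sum>b<r + 1. \<Sum>l<n. if l = j then ?M $$ (a, b * n + l) * p1 b else 0)"
      unfolding sum_lessThan_mult using ij by (intro sum.cong refl) (simp add: L_index p1_def)
    finally show ?thesis using ij by simp
  qed
  have ML1: "?M * ?L1 \<in> carrier_mat ((\<mu> + 1) * m) n" using M L1 by (rule mult_carrier_mat)
  have "(?L2\<^sup>T * (?M * ?L1)) $$ (i, j) = (\<Sum>a<(\<mu> + 1) * m. ?L2 $$ (a, i) * (?M * ?L1) $$ (a, j))"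
    unfolding mult_mat_index_sum[OF transpose_carrier_mat[THEN iffD2, OF L2] ML1 ij]
    using ij L2 by (intro sum.cong refl) simp
  also have "\<dots> = (\<Sum>a<\<mu> + 1. \<Sum>l<m. if l = i then p2 a * (?M * ?L1) $$ (a * m + l, j) else 0)"
    unfolding sum_lessThan_mult using ij by (intro sum.cong refl) (simp add: L_index p2_def del: index_mult_mat(1))
  also have "\<dots> = (\<Sum>a<\<mu> + 1. p2 a * (?M * ?L1) $$ (a * m + i, j))"
    using ij by simp
  also have "\<dots> = (\<Sum>a<\<mu> + 1. p2 a * (\<Sum>b<r + 1. ?M $$ (a * m + i, b * n + j) * p1 b))"
  proof (intro sum.cong refl)
    fix a assume "a \<in> {..<\<mu> + 1}"
    then have "(a + 1) * m \<le> (\<mu> + 1) * m" by (intro mult_le_mono1) simp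
    moreover have "a * m + i < (a + 1) * m" using ij by simp
    ultimately have "a * m + i < (\<mu> + 1) * m" by (rule order.strict_trans2[rotated])
    then show "p2 a * (?M * ?L1) $$ (a * m + i, j) = p2 a * (\<Sum>b<r + 1. ?M $$ (a * m + i, b * n + j) * p1 b)"
      by (simp only: inner)
  qed
  also have "\<dots> = (\<Sum>a<\<mu> + 1. \<Sum>b<r + 1.
      (if a = 0 \<and> b = 0 then c k else 0) + (if a = 0 \<or> b = r then c (k - 1 - a - b) else 0))"
    unfolding sum_distrib_left
  proof (intro sum.cong refl)
    fix a b assume ab: "a \<in> {..<\<mu> + 1}" "b \<in> {..<r + 1}"
    have p1: "newton_poly x \<mu> * p1 b = newton_poly x (k - 1 - b)"
      using newton_poly_split[of b r "k - 1" x] ab by (simp add: p1_def k)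
    have p2: "p2 a = newton_poly x (\<mu> - a)"
      using newton_poly_split[of a \<mu> \<mu> x] ab by (simp add: p2_def newton_poly_def)
    have "newton_poly x k = newton_poly x (k - 1) * node_factor x k"
      using \<mu> by (cases k) (simp_all add: newton_poly_def)
    then have pk: "p2 0 * (node_factor x k * [:P k $$ (i, j):] * p1 0) = c k"
      using p1 newton_poly_split[of 0 r "k - 1" x] p2 newton_poly_split[of 0 \<mu> \<mu> x]
      by (simp add: c_def p1_def p2_def k newton_poly_def algebra_simps)
    have corner: "p2 a * ([:P (k - 1 - a - b) $$ (i, j):] * p1 b) = c (k - 1 - a - b)" if "a = 0 \<or> b = r"
    proof (cases "a = 0")
      case True
      then have "p2 a * ([:P (k - 1 - a - b) $$ (i, j):] * p1 b) =
          [:P (k - 1 - a - b) $$ (i, j):] * (newton_poly x \<mu> * p1 b)"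
        using p2 by (simp add: algebra_simps)
      then show ?thesis using True by (simp only: p1 c_def) simp
    next
      case False
      then have "b = r" using that by simp
      then show ?thesis using p2 by (simp add: c_def p1_def k)
    qed
    have "?M $$ (a * m + i, b * n + j) = (if a = 0 \<and> b = 0 then node_factor x k * [:P k $$ (i, j):] else 0) +
       (if a = 0 \<or> b = r then [:P (k - 1 - a - b) $$ (i, j):] else 0)"
      using newton_M_index[OF P \<mu>, where a = a and b = b and i = i and j = j and x = x] ab ij by (simp add: k)
    then show "p2 a * (?M $$ (a * m + i, b * n + j) * p1 b) =
        (if a = 0 \<and> b = 0 then c k else 0) + (if a = 0 \<or> b = r then c (k - 1 - a - b) else 0)"
      using pk corner by (auto simp: distrib_left distrib_right)
  qed
  also have "\<dots> = c k + (\<Sum>a<\<mu> + 1. \<Sum>b<r + 1. if a = 0 \<or> b = r then c (k - 1 - a - b) else 0)"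
  proof -
    have "(\<Sum>a<\<mu> + 1. \<Sum>b<r + 1. if a = 0 \<and> b = 0 then c k else 0) =
        (\<Sum>a<\<mu> + 1. if a = 0 then \<Sum>b<r + 1. if b = 0 then c k else 0 else 0)"
      by (intro sum.cong) auto
    also have "\<dots> = c k" by (simp del: sum.lessThan_Suc)
    finally show ?thesis by (simp add: sum.distrib del: sum.lessThan_Suc)
  qed
  \<comment> \<open>The block \<open>(0, r)\<close>, common to the row and the column, is counted
    with the column.\<close>
  also have "(\<Sum>a<\<mu> + 1. \<Sum>b<r + 1. if a = 0 \<or> b = r then c (k - 1 - a - b) else 0) =
      (\<Sum>a<\<mu> + 1. (if a = 0 then \<Sum>b<r. c (k - 1 - b) else 0) + c (\<mu> - a))"
    by (intro sum.cong) (auto simp: k)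
  also have "\<dots> = (\<Sum>b<r. c (k - 1 - b)) + (\<Sum>a<\<mu> + 1. c (\<mu> - a))"
    by (simp add: sum.distrib del: sum.lessThan_Suc)
  \<comment> \<open>The row covers the indices from \<open>k - 1\<close> down to
    \<open>\<mu> + 1\<close>, the column those from \<open>\<mu>\<close> down to 0.\<close>
  also have "\<dots> = (\<Sum>b<k. c (k - 1 - b))"
  proof -
    have "(\<Sum>b<r + t. f b) = (\<Sum>b<r. f b) + (\<Sum>b<t. f (r + b))" for t and f :: "nat \<Rightarrow> complex poly"
      by (induction t) (simp_all add: ac_simps)
    from this[of "\<lambda>b. c (k - 1 - b)" "\<mu> + 1"] show ?thesis
      by (simp add: k del: sum.lessThan_Suc)
  qed
  also have "\<dots> = (\<Sum>l<k. c l)"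
    using sum.nat_diff_reindex[of c k] by simp
  also have "c k + (\<Sum>l<k. c l) = (\<Sum>l\<le>k. c l)"
    by (simp add: lessThan_Suc_atMost[symmetric])
  also have "\<dots> = newton_matpoly m n k x P $$ (i, j)"
    using ij by (simp add: newton_matpoly_def c_def)
  finally show "(?L2\<^sup>T * (?M * kron_one n (bidiag_L (\<lambda>a. node_factor x (k - 1 - a)) (k - \<mu> - 1)))) $$ (i, j) =
      newton_matpoly m n k x P $$ (i, j)"
    by (simp only: r_def)
qed (simp_all add: newton_matpoly_def kron_one_def bidiag_L_def)

text \<open>The node factor occurs only in the top left block. The disjunction describes its
  complement symmetrically, so it serves both \<open>newton_M\<close> and its transpose.\<close>

lemma degree_newton_M:
  assumes P: "\<And>i. i \<le> k \<Longrightarrow> P i \<in> carrier_mat m n" and \<mu>: "\<mu> \<le> k - 1" "k \<ge> 1"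
    and i: "i < (\<mu> + 1) * m" and j: "j < (k - \<mu>) * n" and "m \<le> i \<or> n \<le> j"
  shows "degree (newton_M m n k \<mu> x P $$ (i, j)) = 0"
proof -
  have mn: "m > 0" "n > 0" using i j by (cases m; cases n; simp)+
  have "i div m < \<mu> + 1" "j div n < k - \<mu>"
    using i j by (simp_all add: less_mult_imp_div_less)
  then have "newton_M m n k \<mu> x P $$ (i div m * m + i mod m, j div n * n + j mod n) =
    (if i div m = 0 \<and> j div n = 0 then node_factor x k * [:P k $$ (i mod m, j mod n):] else 0) +
    (if i div m = 0 \<or> j div n = k - \<mu> - 1 then [:P (k - 1 - i div m - j div n) $$ (i mod m, j mod n):] else 0)"
    using mn by (intro newton_M_index[OF P \<mu>]) auto
  moreover have "\<not> (i div m = 0 \<and> j div n = 0)"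
    using assms(6) mn by (auto simp: div_eq_0_iff)
  ultimately show ?thesis by simp
qed

theorem theorem3p11:
  fixes k m n \<mu> :: nat
    and x :: "nat \<Rightarrow> complex"
    and P :: "nat \<Rightarrow> complex mat"
    and A B :: "complex mat"
  assumes "k \<ge> 1" and "m \<ge> 1" and "n \<ge> 1"
    and "inj_on x {1..k}"
    and "\<And>i. i \<le> k \<Longrightarrow> P i \<in> carrier_mat m n"
    and "singular_matpoly (newton_matpoly m n k x P)"
    and "\<mu> \<le> k - 1"
    and "A \<in> carrier_mat ((\<mu> + 1) * m) ((k - \<mu> - 1) * n)"
    and "B \<in> carrier_mat (\<mu> * m) ((k - \<mu>) * n)"
  shows "(\<forall>zs. right_minimal_basis (newton_N m n k \<mu> x P A B) zs \<longrightarrow>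
           right_minimal_basis (newton_matpoly m n k x P) (map (vec_block n (k - \<mu> - 1)) zs)) \<and>
         (\<forall>es. right_minimal_indices (newton_N m n k \<mu> x P A B) es \<longrightarrow>
           (\<forall>e \<in> set es. k - \<mu> - 1 \<le> e) \<and>
           right_minimal_indices (newton_matpoly m n k x P) (map (\<lambda>e. e - (k - \<mu> - 1)) es)) \<and>
         (\<forall>ws. left_minimal_basis (newton_N m n k \<mu> x P A B) ws \<longrightarrow>
           left_minimal_basis (newton_matpoly m n k x P) (map (vec_block m \<mu>) ws)) \<and>
         (\<forall>es. left_minimal_indices (newton_N m n k \<mu> x P A B) es \<longrightarrow>
           (\<forall>e \<in> set es. \<mu> \<le> e) \<and>
           left_minimal_indices (newton_matpoly m n k x P) (map (\<lambda>e. e - \<mu>) es))"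
proof -
  define r p1 q1 p2 q2 where "r = k - \<mu> - 1" and "p1 = r * n" and "q1 = (r + 1) * n"
    and "p2 = \<mu> * m" and "q2 = (\<mu> + 1) * m"
  define g1 g2 where "g1 = (\<lambda>a. node_factor x (k - 1 - a))" and "g2 = (\<lambda>a. node_factor x (\<mu> - a))"
  have k: "k - \<mu> = r + 1" using assms(1,7) by (simp add: r_def)
  let ?M = "newton_M m n k \<mu> x P" and ?N = "newton_N m n k \<mu> x P A B" and ?P = "newton_matpoly m n k x P"
  have M: "?M \<in> carrier_mat q2 q1"
    by (simp add: newton_M_def blocks_mat_def q1_def q2_def k)
  have A: "A \<in> carrier_mat q2 p1" and B: "B \<in> carrier_mat p2 q1"
    using assms(8,9) by (simp_all add: p1_def p2_def q1_def q2_def k)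
  have degM: "degree (?M $$ (i, j)) = 0" if "i < q2" "j < q1" "m \<le> i \<or> n \<le> j" for i j
    using that degree_newton_M[OF assms(5,7,1), where i = i and j = j and x = x] by (simp add: q1_def q2_def k)
  interpret R: bidiag_pencil n r p1 q1 m \<mu> p2 q2 g1 g2 ?M "const_mat A" "const_mat B"
    using M A B degM
    by unfold_locales (auto simp: g1_def g2_def degree_node_factor p1_def q1_def p2_def q2_def)
  \<comment> \<open>Transposition exchanges \<open>K1\<close> with \<open>K2\<close>, and the
    transposes of \<open>B\<close> and \<open>A\<close> take the places of \<open>A\<close> and
    \<open>B\<close>.\<close>
  interpret L: bidiag_pencil m \<mu> p2 q2 n r p1 q1 g2 g1 "?M\<^sup>T" "(const_mat B)\<^sup>T" "(const_mat A)\<^sup>T"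
    using M A B degM
    by unfold_locales (auto simp: g1_def g2_def degree_node_factor p1_def q1_def p2_def q2_def)
  have N: "?N = R.pencil"
    unfolding R.pencil_def newton_N_def newton_K1_def newton_K2_def newton_K_eq
    by (simp add: r_def g1_def g2_def p1_def p2_def)
  have P: "?P = R.reduced"
    using newton_matpoly_factorization[OF assms(5,7,1), where x = x]
    unfolding R.reduced_def by (simp add: r_def g1_def g2_def)
  have NT: "?N\<^sup>T = L.pencil"
  proof -
    have AK: "const_mat A * R.K1 \<in> carrier_mat q2 q1" and KB: "R.K2\<^sup>T * const_mat B \<in> carrier_mat q2 q1"
      using A B by (auto intro: mult_carrier_mat[of _ _ p1] mult_carrier_mat[of _ _ p2])
    have "(?M + const_mat A * R.K1 + R.K2\<^sup>T * const_mat B)\<^sup>T =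
        ?M\<^sup>T + R.K1\<^sup>T * (const_mat A)\<^sup>T + (const_mat B)\<^sup>T * R.K2"
      using AK KB transpose_mult[of "const_mat A" q2 p1 R.K1 q1] transpose_mult[of "R.K2\<^sup>T" q2 p2 "const_mat B" q1]
        A B by (simp add: transpose_add[of _ q2 q1])
    \<comment> \<open>The summands are swapped because the product with \<open>K2\<close> now
      occupies the place of \<open>A * K1\<close>.\<close>
    also have "\<dots> = ?M\<^sup>T + (const_mat B)\<^sup>T * R.K2 + R.K1\<^sup>T * (const_mat A)\<^sup>T"
      using A B by (intro eq_matI) auto
    finally show ?thesis
      unfolding N R.pencil_def L.pencil_def
      by (subst transpose_four_block_mat[of _ q2 q1 _ p2 _ p1]) (use AK KB in auto)
  qed
  have PT: "?P\<^sup>T = L.reduced"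
    unfolding P R.reduced_def L.reduced_def
    using transpose_mult[of "R.L2\<^sup>T" m q2 "?M * R.L1" n] transpose_mult[of ?M q2 q1 R.L1 n]
      assoc_mult_mat[of "R.L1\<^sup>T" n q1 "?M\<^sup>T" q2 R.L2 m] mult_carrier_mat[of ?M q2 q1 R.L1 n]
    by simp
  have left: "left_nullspace X = right_nullspace (X\<^sup>T)" for X
    unfolding left_nullspace_def right_nullspace_def by (simp add: map_to_fract_transpose)
  have dims: "dim_col ?N = q1 + p2" "dim_row ?N = q2 + p1" "dim_col ?P = n" "dim_row ?P = m"
    using R.pencil_carrier R.reduced_carrier unfolding N[symmetric] P[symmetric] by auto
  note right_basis = R.minimal_basis_reduced[folded N P]
  note left_basis = L.minimal_basis_reduced[folded NT PT]
  show ?thesis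
    using right_basis left_basis are_minimal_indices_shift[OF right_basis] are_minimal_indices_shift[OF left_basis]
    unfolding right_minimal_basis_def left_minimal_basis_def right_minimal_indices_def left_minimal_indices_def
      left dims r_def[symmetric]
    by simp
qed

end
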